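(* Fix $n\in\mathbb N$ and $0\le\lambda\le1$. Let $f\in\mathcal A_r^n$ and for each $k\in\mathbb N$ let $f_k\in\mathcal A_r^n$ be such that $\|f_k-f\|_{a,n}\to0$. Let $h,h_k\in\mathcal{IBV}^{n-1}$ be such that $\|h_k-h\|_{\mathcal{IBV}^{n-1}}\to0$. Then $$\lim_{k\to\infty}\int_{-\infty}^\infty f_kh_k=\int_{-\infty}^\infty fh.$$
   Context: Write $\overline{\mathbb R}=[-\infty,\infty]$. A function $F:\overline{\mathbb R}\to\mathbb R$ is regulated if the one-sided limits $F(x-),F(x+)$ exist in $\mathbb R$ for every $x\in\mathbb R$ and the limits $\lim_{x\to\pm\infty}F(x)$ exist in $\mathbb R$; by convention $F(\pm\infty)$ equals these limits (also for functions of bounded variation). $\mathcal B_r$ is the space of regulated $F$ with $F(-\infty)=0$ and $F(x)=F(x-)$ for all $x\in\mathbb R$; $\|F\|_\infty=\sup_{x\in\mathbb R}|F(x)|$. $\mathcal A_r^n$ is the set of distributions $f$ on $\mathbb R$ with $f=F^{(n)}$ (distributional derivative) for some $F\in\mathcal B_r$; $F$ is unique (the primitive of $f$) and $\|f\|_{a,n}=\|F\|_\infty$. $\mathcal{BV}$ is the set of functions $g:\overline{\mathbb R}\to\mathbb R$ of bounded variation $Vg<\infty$, with norm $\|g\|_{\mathcal{BV}}=\|g\|_\infty+Vg$. For $\lambda\in[0,1]$, $\mathcal{NBV}_\lambda$ is the set of $g\in\mathcal{BV}$ with $g(x)=(1-\lambda)g(x-)+\lambda g(x+)$ for all $x\in\mathbb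 R$. For locally integrable $q$, $I^0[q]=q$ and $I^m[q](x)=\int_0^xI^{m-1}[q](t)\,dt$; $\mathcal{IBV}^0=\mathcal{BV}$ and $\mathcal{IBV}^m=\{I^m[g]:g\in\mathcal{BV}\}$ for $m\ge1$. For $m\ge1$ each $h\in\mathcal{IBV}^m$ is $I^m[g]$ for a unique $g\in\mathcal{NBV}_\lambda$, and $\|h\|_{\mathcal{IBV}^m}=\|g\|_\infty+Vg$ for this $g$; $\|h\|_{\mathcal{IBV}^0}=\|h\|_{\mathcal{BV}}$. Integral: for $f\in\mathcal A_r^n$ with primitive $F$ and $h\in\mathcal{IBV}^{n-1}$, let $g=h$ if $n=1$, and if $n\ge2$ let $g\in\mathcal{NBV}_\lambda$ be the unique function with $h=I^{n-1}[g]$. Then $\int_{-\infty}^\infty fh=(-1)^{n-1}\int_{-\infty}^\infty g\,dF$, a Henstock--Stieltjes integral: $\int_{-\infty}^\infty g\,dF=A$ means that for each $\epsilon>0$ there is a gauge $\gamma$ (assigning to each $z\in\overline{\mathbb R}$ an open interval of $\overline{\mathbb R}$ containing $z$) such that $|\sum_ig(z_i)[F(x_i)-F(x_{i-1})]-A|<\epsilon$ for every partition $-\infty=x_0<\dots<x_N=\infty$ with tags $z_i\in[x_{i-1},x_i]\subset\gamma(z_i)$. The integral exists for all such $f$ and $h$. *)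

theory Defs
  imports "HOL-Analysis.Analysis"
begin

section \<open>Distributions on the real line\<close>

definition test_functions :: "(real \<Rightarrow> real) set" where
  "test_functions = {\<phi>. (\<forall>k x. (deriv ^^ k) \<phi> differentiable (at x))
                       \<and> compact (closure {x. \<phi> x \<noteq> 0})}"

definition test_tends_to_zero :: "(nat \<Rightarrow> real \<Rightarrow> real) \<Rightarrow> bool" where
  "test_tends_to_zero \<Phi> \<longleftrightarrow>
     (\<forall>j. \<Phi> j \<in> test_functions) \<and>
     (\<exists>K. compact K \<and> (\<forall>j. \<forall>x. x \<notin> K \<longrightarrow> \<Phi> j x = 0)) \<and>
     (\<forall>k. uniform_limit UNIV (\<lambda>j. (deriv ^^ k) (\<Phi> j)) (\<lambda>x. 0) sequentially)"

text \<open>Distributions are the linear, sequentially continuous functionals on the test functions.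
  A functional is given the value 0 off the test functions, so that equality of distributions is
  equality of HOL functions and differences of distributions are pointwise differences.\<close>

definition distributions :: "((real \<Rightarrow> real) \<Rightarrow> real) set" where
  "distributions = {T.
     (\<forall>\<phi>. \<phi> \<notin> test_functions \<longrightarrow> T \<phi> = 0) \<and>
     (\<forall>\<phi>\<in>test_functions. \<forall>\<psi>\<in>test_functions. \<forall>a b.
        T (\<lambda>x. a * \<phi> x + b * \<psi> x) = a * T \<phi> + b * T \<psi>) \<and>
     (\<forall>\<Phi>. test_tends_to_zero \<Phi> \<longrightarrow> (\<lambda>j. T (\<Phi> j)) \<longlonglongrightarrow> 0)}"

definition regular_distribution :: "(real \<Rightarrow> real) \<Rightarrow> (real \<Rightarrow> real) \<Rightarrow> real" where
  "regular_distribution q = (\<lambda>\<phi>. if \<phi> \<in> test_functions then LBINT x. q x * \<phi> x else 0)"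

definition distr_deriv :: "((real \<Rightarrow> real) \<Rightarrow> real) \<Rightarrow> (real \<Rightarrow> real) \<Rightarrow> real" where
  "distr_deriv T = (\<lambda>\<phi>. if \<phi> \<in> test_functions then - T (deriv \<phi>) else 0)"


section \<open>Regulated functions and the distributions they generate\<close>

text \<open>Limits are taken along the reals; the last two conditions combine the existence of the limits
  at infinity with the convention that they are the values there.\<close>

definition regulated :: "(ereal \<Rightarrow> real) \<Rightarrow> bool" where
  "regulated F \<longleftrightarrow>
     (\<forall>x::real. (\<exists>l. ((\<lambda>t. F (ereal t)) \<longlongrightarrow> l) (at_left x)) \<and>
                (\<exists>l. ((\<lambda>t. F (ereal t)) \<longlongrightarrow> l) (at_right x))) \<and>
     ((\<lambda>t. F (ereal t)) \<longlongrightarrow> F \<infinity>) at_top \<and>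
     ((\<lambda>t. F (ereal t)) \<longlongrightarrow> F (-\<infinity>)) at_bot"

definition left_lim :: "(ereal \<Rightarrow> real) \<Rightarrow> real \<Rightarrow> real" where
  "left_lim F x = Lim (at_left x) (\<lambda>t. F (ereal t))"

definition right_lim :: "(ereal \<Rightarrow> real) \<Rightarrow> real \<Rightarrow> real" where
  "right_lim F x = Lim (at_right x) (\<lambda>t. F (ereal t))"

definition sup_norm :: "(ereal \<Rightarrow> real) \<Rightarrow> real" where
  "sup_norm F = (SUP x::real. \<bar>F (ereal x)\<bar>)"

definition B_r :: "(ereal \<Rightarrow> real) set" where
  "B_r = {F. regulated F \<and> F (-\<infinity>) = 0 \<and> (\<forall>x::real. F (ereal x) = left_lim F x)}"

definition is_primitive :: "nat \<Rightarrow> ((real \<Rightarrow> real) \<Rightarrow> real) \<Rightarrow> (ereal \<Rightarrow> real) \<Rightarrow> bool" where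
  "is_primitive n f F \<longleftrightarrow>
     F \<in> B_r \<and> f = (distr_deriv ^^ n) (regular_distribution (\<lambda>x. F (ereal x)))"

definition A_r :: "nat \<Rightarrow> ((real \<Rightarrow> real) \<Rightarrow> real) set" where
  "A_r n = {f \<in> distributions. \<exists>F. is_primitive n f F}"

definition primitive :: "nat \<Rightarrow> ((real \<Rightarrow> real) \<Rightarrow> real) \<Rightarrow> ereal \<Rightarrow> real" where
  "primitive n f = (THE F. is_primitive n f F)"

definition norm_a :: "nat \<Rightarrow> ((real \<Rightarrow> real) \<Rightarrow> real) \<Rightarrow> real" where
  "norm_a n f = sup_norm (primitive n f)"


section \<open>Functions of bounded variation and their iterated integrals\<close>

definition variation_sums :: "(ereal \<Rightarrow> real) \<Rightarrow> real set" where
  "variation_sums g =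
     {(\<Sum>i<N. \<bar>g (x (Suc i)) - g (x i)\<bar>) | (x :: nat \<Rightarrow> ereal) N. \<forall>i<N. x i < x (Suc i)}"

definition variation :: "(ereal \<Rightarrow> real) \<Rightarrow> real" where
  "variation g = Sup (variation_sums g)"

text \<open>As for regulated functions, the values at infinity are the limits there.\<close>

definition BV :: "(ereal \<Rightarrow> real) set" where
  "BV = {g. bdd_above (variation_sums g) \<and>
            ((\<lambda>t. g (ereal t)) \<longlongrightarrow> g \<infinity>) at_top \<and>
            ((\<lambda>t. g (ereal t)) \<longlongrightarrow> g (-\<infinity>)) at_bot}"

definition norm_BV :: "(ereal \<Rightarrow> real) \<Rightarrow> real" where
  "norm_BV g = sup_norm g + variation g"

definition NBV :: "real \<Rightarrow> (ereal \<Rightarrow> real) set" where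
  "NBV lam = {g \<in> BV. \<forall>x::real. g (ereal x) = (1 - lam) * left_lim g x + lam * right_lim g x}"

text \<open>For \<open>m \<ge> 1\<close> the function \<open>iter_int m q\<close> lives on the reals and may be unbounded. Its values
  at \<open>\<plusminus>\<infinity>\<close> carry no information and are set to 0, which makes \<open>iter_int m\<close> linear there too.\<close>

primrec iter_int :: "nat \<Rightarrow> (ereal \<Rightarrow> real) \<Rightarrow> ereal \<Rightarrow> real" where
  "iter_int 0 q = q"
| "iter_int (Suc m) q =
     (\<lambda>x. if \<bar>x\<bar> = \<infinity> then 0 else LBINT t=0..x. iter_int m q (ereal t))"

definition IBV :: "nat \<Rightarrow> (ereal \<Rightarrow> real) set" where
  "IBV m = iter_int m ` BV"

definition bv_part :: "nat \<Rightarrow> real \<Rightarrow> (ereal \<Rightarrow> real) \<Rightarrow> ereal \<Rightarrow> real" where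
  "bv_part m lam h = (if m = 0 then h else (THE g. g \<in> NBV lam \<and> h = iter_int m g))"

definition norm_IBV :: "nat \<Rightarrow> real \<Rightarrow> (ereal \<Rightarrow> real) \<Rightarrow> real" where
  "norm_IBV m lam h = norm_BV (bv_part m lam h)"


section \<open>The integral\<close>

definition interval_gauge :: "(ereal \<Rightarrow> ereal set) \<Rightarrow> bool" where
  "interval_gauge \<gamma> \<longleftrightarrow> gauge \<gamma> \<and> (\<forall>z. \<forall>a\<in>\<gamma> z. \<forall>b\<in>\<gamma> z. {a..b} \<subseteq> \<gamma> z)"

definition fine_partition ::
  "(ereal \<Rightarrow> ereal set) \<Rightarrow> nat \<Rightarrow> (nat \<Rightarrow> ereal) \<Rightarrow> (nat \<Rightarrow> ereal) \<Rightarrow> bool" where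
  "fine_partition \<gamma> N x z \<longleftrightarrow>
     x 0 = -\<infinity> \<and> x N = \<infinity> \<and>
     (\<forall>i<N. x i < x (Suc i) \<and> z i \<in> {x i..x (Suc i)} \<and> {x i..x (Suc i)} \<subseteq> \<gamma> (z i))"

definition has_HS_integral ::
  "(ereal \<Rightarrow> real) \<Rightarrow> (ereal \<Rightarrow> real) \<Rightarrow> real \<Rightarrow> bool" where
  "has_HS_integral g F A \<longleftrightarrow>
     (\<forall>e>0. \<exists>\<gamma>. interval_gauge \<gamma> \<and>
        (\<forall>N x z. fine_partition \<gamma> N x z \<longrightarrow>
           \<bar>(\<Sum>i<N. g (z i) * (F (x (Suc i)) - F (x i))) - A\<bar> < e))"

definition HS_integral :: "(ereal \<Rightarrow> real) \<Rightarrow> (ereal \<Rightarrow> real) \<Rightarrow> real" where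
  "HS_integral g F = (THE A. has_HS_integral g F A)"

definition integral_prod ::
  "nat \<Rightarrow> real \<Rightarrow> ((real \<Rightarrow> real) \<Rightarrow> real) \<Rightarrow> (ereal \<Rightarrow> real) \<Rightarrow> real" where
  "integral_prod n lam f h = (-1) ^ (n - 1) * HS_integral (bv_part (n - 1) lam h) (primitive n f)"

end

theory Submission
  imports Defs
begin

text \<open>
  Summation by parts bounds the Riemann sums of \<open>\<integral>g dF\<close> by \<open>2 \<parallel>F\<parallel> \<parallel>g\<parallel>\<close>, where \<open>\<parallel>g\<parallel>\<close> is the norm of
  bounded variation. Since left-continuous regulated functions are uniform limits of step functions,
  whose integrals are finite sums of values of \<open>g\<close>, the integral exists and is a bounded bilinear
  form, hence continuous. What remains is that \<open>f \<mapsto> F\<close> and \<open>h \<mapsto> g\<close> are well defined and additive.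
  For \<open>F\<close>: if the \<open>n\<close>-th distributional derivative of \<open>F\<close> vanishes, so does \<open>F\<close>, because
  \<open>F(-\<infinity>) = 0\<close> and differences of translates of test functions are derivatives of test functions.
  For \<open>g\<close>: normalising \<open>g\<close> changes it at countably many points only, and iterated integration is
  injective on normalised functions.
\<close>

section \<open>Henstock--Stieltjes integrals\<close>

text \<open>The obstacle is that \<open>F\<close> has only a sup norm and no variation bound, so
  increments of \<open>F\<close> cannot be summed absolutely; this is why they are traded for
  increments of \<open>g\<close> along the tags. The extended line is order-complete with endpoints,
  so one continuation principle on \<open>ereal\<close> yields both the fine partitions and the step
  approximations. The steps are built from indicators of \<open>{a<..}\<close>, the left-continuous
  jumps, against which the integral of \<open>g\<close> is just \<open>g a\<close>. The hypotheses
  control norms of differences, and these norms are defined through definite descriptions (for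
  \<open>g\<close> when \<open>n \<ge> 2\<close>); hence the algebra of primitives and
  representatives has to be settled before the estimate applies. For \<open>F\<close>, the induction
  on \<open>n\<close> carries two properties of a functional that survive differentiation, so
  intermediate derivatives need no description as functions. For \<open>g\<close>, the condition
  \<open>0 \<le> lam \<le> 1\<close> enters through convexity: normalising a monotone function
  leaves it monotone, so bounded variation persists.\<close>

lemma ereal_continuation:
  fixes Q :: "ereal \<Rightarrow> bool"
  assumes bot: "Q (-\<infinity>)"
    and step: "\<And>z. \<exists>U. open U \<and> z \<in> U \<and> (\<forall>a\<in>U. \<forall>b\<in>U. a \<le> z \<longrightarrow> z \<le> b \<longrightarrow> Q a \<longrightarrow> Q b)"
  shows "Q \<infinity>"
proof -
  \<comment> \<open>\<open>Q\<close> holds at some point of \<open>U\<close> at or below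
    \<open>s\<close>, so the step at \<open>s\<close> carries it to every point of \<open>U\<close>
    at or above \<open>s\<close>. If \<open>s < \<infinity>\<close> this overshoots the supremum; if
    \<open>s = \<infinity>\<close> it reaches \<open>s\<close> itself.\<close>
  define s where "s = Sup {x. Q x}"
  obtain U where U: "open U" "s \<in> U"
    and Q: "\<And>a b. a \<in> U \<Longrightarrow> b \<in> U \<Longrightarrow> a \<le> s \<Longrightarrow> s \<le> b \<Longrightarrow> Q a \<Longrightarrow> Q b"
    using step[of s] by blast
  have "\<exists>a\<in>U. a \<le> s \<and> Q a"
  proof (cases "s = -\<infinity>")
    case True
    then show ?thesis using U bot by auto
  next
    case False
    then have "-\<infinity> < s" by simp
    then obtain u where u: "u < s" "{u<..s} \<subseteq> U"
      using open_left[OF U(1) U(2)] by blast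
    then obtain a where "Q a" "u < a"
      unfolding s_def by (auto simp: less_Sup_iff)
    moreover have "a \<le> s" unfolding s_def using \<open>Q a\<close> by (auto intro: Sup_upper)
    ultimately show ?thesis using u by auto
  qed
  then obtain a where a: "a \<in> U" "a \<le> s" "Q a" by blast
  show ?thesis
  proof (cases "s = \<infinity>")
    case True
    then show ?thesis using Q[OF a(1) U(2) a(2) _ a(3)] by simp
  next
    case False
    then have "s < \<infinity>" by simp
    then obtain v where v: "s < v" "{s..<v} \<subseteq> U"
      using open_right[OF U(1) U(2)] by blast
    obtain b where b: "s < b" "b < v" using dense v(1) by blast
    then have "b \<in> U" "s \<le> b" using v(2) by auto
    then have "Q b" using Q a by blast
    then have "b \<le> s" unfolding s_def by (auto intro: Sup_upper)
    then show ?thesis using b by auto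
  qed
qed

section \<open>Gauges, fine partitions and linearity of the integral\<close>

lemma interval_gauge_open: "interval_gauge \<gamma> \<Longrightarrow> open (\<gamma> z)"
  and interval_gauge_mem: "interval_gauge \<gamma> \<Longrightarrow> z \<in> \<gamma> z"
  by (auto simp: interval_gauge_def gauge_def)

lemma interval_gauge_Int:
  assumes "interval_gauge \<gamma>" "interval_gauge \<delta>"
  shows "interval_gauge (\<lambda>z. \<gamma> z \<inter> \<delta> z)"
  using assms unfolding interval_gauge_def gauge_def by blast

lemma fine_partition_Int:
  "fine_partition (\<lambda>z. \<gamma> z \<inter> \<delta> z) N x z \<longleftrightarrow> fine_partition \<gamma> N x z \<and> fine_partition \<delta> N x z"
  unfolding fine_partition_def by auto

text \<open>Cousin's lemma: a fine partition up to \<open>a\<close> near \<open>z0\<close> is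
  extended by the single interval \<open>{a..b}\<close> with tag \<open>z0\<close>, which the
  convexity of \<open>\<gamma> z0\<close> makes admissible. Without it
  \<open>has_HS_integral\<close> could hold vacuously, and the integral would not be unique.\<close>

lemma fine_partition_exists:
  assumes "interval_gauge \<gamma>"
  shows "\<exists>N x z. fine_partition \<gamma> N x z"
proof -
  let ?Q = "\<lambda>b. \<exists>N x z. x 0 = -\<infinity> \<and> x N = b \<and>
     (\<forall>i<N. x i < x (Suc i) \<and> z i \<in> {x i..x (Suc i)} \<and> {x i..x (Suc i)} \<subseteq> \<gamma> (z i))"
  have "?Q \<infinity>"
  proof (rule ereal_continuation[where Q = "?Q"])
    show "?Q (-\<infinity>)" by (rule exI[of _ 0], rule exI[of _ "\<lambda>_. -\<infinity>"]) simp
  next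
    fix z0
    have "?Q b" if "a \<in> \<gamma> z0" "b \<in> \<gamma> z0" "a \<le> z0" "z0 \<le> b" "?Q a" for a b
    \<comment> \<open>Intervals of a partition are nondegenerate, so nothing may be appended when
      \<open>a = b\<close>.\<close>
    proof (cases "a = b")
      case True
      then show ?thesis using that by simp
    next
      case False
      then have "a < b" using that by auto
      from that obtain N x z where p: "x 0 = -\<infinity>" "x N = a"
        "\<And>i. i < N \<Longrightarrow> x i < x (Suc i) \<and> z i \<in> {x i..x (Suc i)} \<and> {x i..x (Suc i)} \<subseteq> \<gamma> (z i)"
        by blast
      have ab: "{a..b} \<subseteq> \<gamma> z0" using assms that unfolding interval_gauge_def by blast
      have "(x(Suc N := b)) i < (x(Suc N := b)) (Suc i) \<and>
          (z(N := z0)) i \<in> {(x(Suc N := b)) i..(x(Suc N := b)) (Suc i)} \<and>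
          {(x(Suc N := b)) i..(x(Suc N := b)) (Suc i)} \<subseteq> \<gamma> ((z(N := z0)) i)" if "i < Suc N" for i
        using p(2) p(3)[of i] ab \<open>a \<le> z0\<close> \<open>z0 \<le> b\<close> \<open>a < b\<close> that by (cases "i = N") auto
      moreover have "(x(Suc N := b)) 0 = -\<infinity>" "(x(Suc N := b)) (Suc N) = b" using p(1) by auto
      ultimately show ?thesis
        by (intro exI[of _ "Suc N"] exI[of _ "x(Suc N := b)"] exI[of _ "z(N := z0)"]) simp
    qed
    then show "\<exists>U. open U \<and> z0 \<in> U \<and> (\<forall>a\<in>U. \<forall>b\<in>U. a \<le> z0 \<longrightarrow> z0 \<le> b \<longrightarrow> ?Q a \<longrightarrow> ?Q b)"
      by (intro exI[of _ "\<gamma> z0"] conjI ballI impI interval_gauge_open[OF assms] interval_gauge_mem[OF assms])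
  qed
  then show ?thesis unfolding fine_partition_def by simp
qed

abbreviation HS_sum :: "(ereal \<Rightarrow> real) \<Rightarrow> (ereal \<Rightarrow> real) \<Rightarrow> nat \<Rightarrow> (nat \<Rightarrow> ereal) \<Rightarrow> (nat \<Rightarrow> ereal) \<Rightarrow> real"
  where "HS_sum g F N x z \<equiv> \<Sum>i<N. g (z i) * (F (x (Suc i)) - F (x i))"

lemma has_HS_integralD:
  assumes "has_HS_integral g F A" "e > 0"
  shows "\<exists>\<gamma>. interval_gauge \<gamma> \<and> (\<forall>N x z. fine_partition \<gamma> N x z \<longrightarrow> \<bar>HS_sum g F N x z - A\<bar> < e)"
  using assms unfolding has_HS_integral_def by blast

text \<open>A fine partition for the intersection of the two gauges compares the two Riemann sums.\<close>

lemma has_HS_integral_close: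
  assumes "has_HS_integral g F A" "has_HS_integral g' F' A'"
    and close: "\<And>\<gamma> N x z. fine_partition \<gamma> N x z \<Longrightarrow> \<bar>HS_sum g F N x z - HS_sum g' F' N x z\<bar> \<le> c"
  shows "\<bar>A - A'\<bar> \<le> c"
proof (rule field_le_epsilon)
  fix e :: real assume "e > 0"
  then have e: "e/2 > 0" by simp
  obtain \<gamma> where \<gamma>: "interval_gauge \<gamma>" "\<And>N x z. fine_partition \<gamma> N x z \<Longrightarrow> \<bar>HS_sum g F N x z - A\<bar> < e/2"
    using has_HS_integralD[OF assms(1) e] by blast
  obtain \<delta> where \<delta>: "interval_gauge \<delta>" "\<And>N x z. fine_partition \<delta> N x z \<Longrightarrow> \<bar>HS_sum g' F' N x z - A'\<bar> < e/2"
    using has_HS_integralD[OF assms(2) e] by blast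
  obtain N x z where p: "fine_partition (\<lambda>z. \<gamma> z \<inter> \<delta> z) N x z"
    using fine_partition_exists[OF interval_gauge_Int[OF \<gamma>(1) \<delta>(1)]] by blast
  have "\<bar>HS_sum g F N x z - A\<bar> < e/2" "\<bar>HS_sum g' F' N x z - A'\<bar> < e/2"
    using p \<gamma>(2) \<delta>(2) unfolding fine_partition_Int by auto
  then show "\<bar>A - A'\<bar> \<le> c + e" using close[OF p] by linarith
qed

lemma has_HS_integral_unique:
  assumes "has_HS_integral g F A" "has_HS_integral g F A'"
  shows "A = A'"
  using has_HS_integral_close[OF assms, of 0] by simp

lemma HS_integral_eqI: "has_HS_integral g F A \<Longrightarrow> HS_integral g F = A"
  unfolding HS_integral_def using has_HS_integral_unique by blast

text \<open>Only an identity between Riemann sums enters, so one argument serves linearity in the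
  integrand as well as in the integrator.\<close>

lemma has_HS_integral_combine:
  assumes "has_HS_integral g F A" "has_HS_integral g' F' A'"
    and sums: "\<And>N x z. HS_sum g'' F'' N x z = HS_sum g F N x z + c * HS_sum g' F' N x z"
  shows "has_HS_integral g'' F'' (A + c * A')"
  unfolding has_HS_integral_def
proof (intro allI impI)
  fix e :: real assume "e > 0"
  \<comment> \<open>The summand 1 keeps the denominator positive when \<open>c = 0\<close>.\<close>
  then have e: "e/2 > 0" "e / (2 * (\<bar>c\<bar> + 1)) > 0" by simp_all
  obtain \<gamma> where \<gamma>: "interval_gauge \<gamma>" "\<And>N x z. fine_partition \<gamma> N x z \<Longrightarrow> \<bar>HS_sum g F N x z - A\<bar> < e/2"
    using has_HS_integralD[OF assms(1) e(1)] by blast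
  obtain \<delta> where \<delta>: "interval_gauge \<delta>"
    "\<And>N x z. fine_partition \<delta> N x z \<Longrightarrow> \<bar>HS_sum g' F' N x z - A'\<bar> < e / (2 * (\<bar>c\<bar> + 1))"
    using has_HS_integralD[OF assms(2) e(2)] by blast
  have "\<bar>HS_sum g'' F'' N x z - (A + c * A')\<bar> < e" if p: "fine_partition (\<lambda>z. \<gamma> z \<inter> \<delta> z) N x z" for N x z
  proof -
    have *: "\<bar>HS_sum g F N x z - A\<bar> < e/2" "\<bar>HS_sum g' F' N x z - A'\<bar> < e / (2 * (\<bar>c\<bar> + 1))"
      using p \<gamma>(2) \<delta>(2) unfolding fine_partition_Int by auto
    have "\<bar>c * (HS_sum g' F' N x z - A')\<bar> \<le> \<bar>c\<bar> * (e / (2 * (\<bar>c\<bar> + 1)))"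
      unfolding abs_mult using *(2) by (intro mult_left_mono) auto
    also have "\<dots> \<le> e/2" using \<open>e > 0\<close> by (simp add: field_simps)
    finally have "\<bar>c * HS_sum g' F' N x z - c * A'\<bar> \<le> e/2" by (simp add: right_diff_distrib)
    then show ?thesis using *(1) unfolding sums by linarith
  qed
  then show "\<exists>\<gamma>. interval_gauge \<gamma> \<and>
        (\<forall>N x z. fine_partition \<gamma> N x z \<longrightarrow> \<bar>HS_sum g'' F'' N x z - (A + c * A')\<bar> < e)"
    using interval_gauge_Int[OF \<gamma>(1) \<delta>(1)] by blast
qed

lemma has_HS_integral_add_integrator:
  assumes "has_HS_integral g F A" "has_HS_integral g F' A'"
  shows "has_HS_integral g (\<lambda>x. F x + c * F' x) (A + c * A')"
  by (rule has_HS_integral_combine[OF assms])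
    (simp add: sum_distrib_left sum.distrib[symmetric] algebra_simps)

lemma has_HS_integral_diff_integrand:
  assumes "has_HS_integral g F A" "has_HS_integral g' F A'"
  shows "has_HS_integral (g - g') F (A - A')"
  using has_HS_integral_combine[OF assms, of "g - g'" F "-1"]
  by (simp add: sum_subtractf[symmetric] algebra_simps)

lemma has_HS_integral_diff_integrator:
  assumes "has_HS_integral g F A" "has_HS_integral g F' A'"
  shows "has_HS_integral g (F - F') (A - A')"
  using has_HS_integral_combine[OF assms, of g "F - F'" "-1"]
  by (simp add: sum_subtractf[symmetric] algebra_simps)

lemma has_HS_integral_zero: "has_HS_integral g (\<lambda>x. 0) 0"
proof -
  have "interval_gauge (\<lambda>z. UNIV)" by (auto simp: interval_gauge_def gauge_def)
  then show ?thesis unfolding has_HS_integral_def by auto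
qed

text \<open>The gauge forces \<open>a\<close> to be a tag: no other tag has \<open>a\<close> in its neighbourhood.\<close>

lemma has_HS_integral_jump:
  "\<exists>A. has_HS_integral g (indicator {a<..}) A"
proof (cases "a = \<infinity>")
  case True
  then have "indicator {a<..} = (\<lambda>x. 0 :: real)" by (auto simp: indicator_def)
  then show ?thesis using has_HS_integral_zero[of g] by auto
next
  case False
  define \<gamma> where "\<gamma> z = (if z < a then {..<a} else if z > a then {a<..} else UNIV)" for z
  have \<gamma>: "interval_gauge \<gamma>" unfolding interval_gauge_def gauge_def \<gamma>_def by auto
  have "HS_sum g (indicator {a<..}) N x z = g a" if p: "fine_partition \<gamma> N x z" for N x z
  proof -
    have jump: "g (z i) * (indicator {a<..} (x (Suc i)) - indicator {a<..} (x i)) =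
       g a * (indicator {a<..} (x (Suc i)) - indicator {a<..} (x i))" if "i < N" for i
    proof (cases "x i \<le> a \<and> a < x (Suc i)")
      case True
      then have "a \<in> \<gamma> (z i)" using p that unfolding fine_partition_def by fastforce
      then have "z i = a" unfolding \<gamma>_def by (auto split: if_splits)
      then show ?thesis by simp
    next
      case False
      moreover have "x i < x (Suc i)" using p that unfolding fine_partition_def by blast
      ultimately have "indicator {a<..} (x (Suc i)) = (indicator {a<..} (x i) :: real)"
        by (auto simp: indicator_def)
      then show ?thesis by simp
    qed
    have "HS_sum g (indicator {a<..}) N x z = (\<Sum>i<N. g a * (indicator {a<..} (x (Suc i)) - indicator {a<..} (x i)))"
      using jump by (intro sum.cong) auto
    \<comment> \<open>The sum telescopes to the jump between the two infinities. It is 1 for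
      \<open>a = -\<infinity>\<close> as well, because the half-line omits \<open>a\<close>; for
      \<open>a = \<infinity>\<close> the half-line is empty, hence the separate case.\<close>
    also have "\<dots> = g a * (indicator {a<..} (x N) - indicator {a<..} (x 0))"
      by (simp add: sum_distrib_left[symmetric] sum_lessThan_telescope[of "\<lambda>i. indicator {a<..} (x i) :: real"])
    also have "\<dots> = g a" using p False by (simp add: fine_partition_def)
    finally show ?thesis .
  qed
  then show ?thesis unfolding has_HS_integral_def using \<gamma> by (intro exI[of _ "g a"]) auto
qed

text \<open>Each generator is left-continuous on the reals and vanishes at
  \<open>-\<infinity>\<close>, like the members of \<open>B_r\<close>. Building by single jumps lets
  integrability follow from one jump and linearity. The choice \<open>a = -\<infinity>\<close> is
  allowed and shifts all values except the one at \<open>-\<infinity>\<close>.\<close>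

inductive_set step_functions :: "(ereal \<Rightarrow> real) set" where
  zero: "(\<lambda>x. 0) \<in> step_functions"
| jump: "s \<in> step_functions \<Longrightarrow> (\<lambda>x. s x + c * indicator {a<..} x) \<in> step_functions"

lemma has_HS_integral_step: "s \<in> step_functions \<Longrightarrow> \<exists>A. has_HS_integral g s A"
proof (induction rule: step_functions.induct)
  case zero
  then show ?case using has_HS_integral_zero by blast
next
  case (jump s c a)
  then show ?case using has_HS_integral_add_integrator has_HS_integral_jump[of g a] by blast
qed

subsection \<open>Variation\<close>

text \<open>Repeated points contribute zero terms and are dropped, which leaves a strictly
  increasing chain as in \<open>variation_sums\<close>. The weak form is required because
  neighbouring tags of a partition may coincide.\<close>

lemma variation_sum_le:
  assumes bdd: "bdd_above (variation_sums g)" and mono: "\<And>i. i < N \<Longrightarrow> x i \<le> x (Suc i)"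
  shows "(\<Sum>i<N. \<bar>g (x (Suc i)) - g (x i)\<bar>) \<le> variation g"
proof -
  have "\<exists>y M. (\<forall>i<M. y i < y (Suc i)) \<and> y M = x N \<and>
      (\<Sum>i<M. \<bar>g (y (Suc i)) - g (y i)\<bar>) = (\<Sum>i<N. \<bar>g (x (Suc i)) - g (x i)\<bar>)"
    using mono
  proof (induction N)
    case 0
    show ?case by (rule exI[of _ x], rule exI[of _ 0]) simp
  next
    case (Suc N)
    then obtain y M where y: "\<forall>i<M. y i < y (Suc i)" "y M = x N"
      "(\<Sum>i<M. \<bar>g (y (Suc i)) - g (y i)\<bar>) = (\<Sum>i<N. \<bar>g (x (Suc i)) - g (x i)\<bar>)" by auto
    show ?case
    proof (cases "x N = x (Suc N)")
      case True
      then show ?thesis using y by auto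
    next
      case False
      then have less: "x N < x (Suc N)" using Suc.prems[of N] by auto
      have "(\<Sum>i<M. \<bar>g ((y(Suc M := x (Suc N))) (Suc i)) - g ((y(Suc M := x (Suc N))) i)\<bar>) =
          (\<Sum>i<M. \<bar>g (y (Suc i)) - g (y i)\<bar>)"
        by (intro sum.cong) auto
      then show ?thesis
        by (intro exI[of _ "y(Suc M := x (Suc N))"] exI[of _ "Suc M"])
          (use y less in \<open>auto simp: less_Suc_eq\<close>)
    qed
  qed
  then obtain y M where "(\<forall>i<M. y i < y (Suc i))"
      "(\<Sum>i<M. \<bar>g (y (Suc i)) - g (y i)\<bar>) = (\<Sum>i<N. \<bar>g (x (Suc i)) - g (x i)\<bar>)" by blast
  then have "(\<Sum>i<N. \<bar>g (x (Suc i)) - g (x i)\<bar>) \<in> variation_sums g"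
    unfolding variation_sums_def by (auto intro!: exI[of _ y] exI[of _ M])
  then show ?thesis unfolding variation_def by (intro cSup_upper bdd)
qed

lemma variation_nonneg: "bdd_above (variation_sums g) \<Longrightarrow> 0 \<le> variation g"
  using variation_sum_le[of g 0 "\<lambda>_. 0"] by simp

lemma diff_le_variation:
  assumes "bdd_above (variation_sums g)" shows "\<bar>g x - g y\<bar> \<le> variation g"
proof -
  have *: "\<bar>g b - g a\<bar> \<le> variation g" if "a \<le> b" for a b
    using variation_sum_le[OF assms, of 1 "\<lambda>i. if i = 0 then a else b"] that by simp
  show ?thesis using *[of x y] *[of y x] by (cases "x \<le> y") auto
qed

lemma summation_by_parts:
  fixes g F :: "nat \<Rightarrow> real"
  shows "(\<Sum>i<Suc n. g i * (F (Suc i) - F i)) =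
    g n * F (Suc n) - g 0 * F 0 - (\<Sum>i<n. F (Suc i) * (g (Suc i) - g i))"
  by (induction n) (auto simp: algebra_simps)

text \<open>The point \<open>x (Suc i)\<close> separates the tags of the intervals it joins, so the
  tags form an increasing chain and their increments are controlled by the variation of
  \<open>g\<close>. The summand \<open>2 * M\<close> pays for the two boundary terms of the
  summation by parts.\<close>

lemma HS_sum_bound:
  assumes g: "bdd_above (variation_sums g)" "\<And>x. \<bar>g x\<bar> \<le> M"
    and F: "\<And>x. \<bar>F x\<bar> \<le> B" and p: "fine_partition \<gamma> N x z"
  shows "\<bar>HS_sum g F N x z\<bar> \<le> B * (2 * M + variation g)"
proof -
  have "N \<noteq> 0" using p unfolding fine_partition_def by (cases "N = 0") auto
  then obtain n where N: "N = Suc n" using not0_implies_Suc by blast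
  have B: "0 \<le> B" using F[of 0] by linarith
  have mono: "z i \<le> z (Suc i)" if "i < n" for i
  proof -
    have "z i \<le> x (Suc i)" "x (Suc i) \<le> z (Suc i)"
      using p that unfolding fine_partition_def N by auto
    then show ?thesis by simp
  qed
  have *: "\<bar>g y * F y'\<bar> \<le> B * M" for y y'
    unfolding abs_mult using mult_mono[OF g(2)[of y] F[of y']] g(2)[of y] by (simp add: mult.commute)
  have "\<bar>\<Sum>i<n. F (x (Suc i)) * (g (z (Suc i)) - g (z i))\<bar> \<le> (\<Sum>i<n. \<bar>F (x (Suc i)) * (g (z (Suc i)) - g (z i))\<bar>)"
    by (rule sum_abs)
  also have "\<dots> \<le> (\<Sum>i<n. B * \<bar>g (z (Suc i)) - g (z i)\<bar>)"
    unfolding abs_mult using F by (intro sum_mono mult_right_mono) auto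
  also have "\<dots> \<le> B * variation g"
    unfolding sum_distrib_left[symmetric] using variation_sum_le[OF g(1), of n z] mono B
    by (intro mult_left_mono) auto
  finally have "\<bar>\<Sum>i<n. F (x (Suc i)) * (g (z (Suc i)) - g (z i))\<bar> \<le> B * variation g" .
  then show ?thesis
    unfolding N summation_by_parts[of "\<lambda>i. g (z i)" "\<lambda>i. F (x i)"]
    using *[of "z n" "x (Suc n)"] *[of "z 0" "x 0"] by (simp add: algebra_simps)
qed

lemma HS_integral_bound:
  assumes "has_HS_integral g F A" "bdd_above (variation_sums g)" "\<And>x. \<bar>g x\<bar> \<le> M" "\<And>x. \<bar>F x\<bar> \<le> B"
  shows "\<bar>A\<bar> \<le> B * (2 * M + variation g)"
proof -
  have "\<bar>A - 0\<bar> \<le> B * (2 * M + variation g)"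
    by (rule has_HS_integral_close[OF assms(1) has_HS_integral_zero[of g]])
      (use HS_sum_bound[OF assms(2-4)] in simp)
  then show ?thesis by simp
qed

text \<open>The bound on Riemann sums is uniform over all partitions. Hence uniformly close
  integrators have uniformly close sums: the integrals of the approximants form a Cauchy sequence,
  and a gauge for one good approximant serves \<open>F\<close> too.\<close>

lemma has_HS_integral_uniform_limit:
  assumes g: "bdd_above (variation_sums g)" "\<And>x. \<bar>g x\<bar> \<le> M"
    and approx: "\<And>e. e > 0 \<Longrightarrow> \<exists>s A. has_HS_integral g s A \<and> (\<forall>x. \<bar>F x - s x\<bar> \<le> e)"
  shows "\<exists>A. has_HS_integral g F A"
proof -
  \<comment> \<open>The summand 1 makes \<open>K\<close> strictly positive, so that it can be
    divided by.\<close>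
  define K where "K = 2 * M + variation g + 1"
  have K: "K > 0" using g(2)[of 0] variation_nonneg[OF g(1)] unfolding K_def by linarith
  have "\<forall>n. \<exists>s A. has_HS_integral g s A \<and> (\<forall>x. \<bar>F x - s x\<bar> \<le> 1 / real (Suc n))"
    using approx by simp
  then obtain s A where sA: "\<And>n. has_HS_integral g (s n) (A n)"
    and s: "\<And>n x. \<bar>F x - s n x\<bar> \<le> 1 / real (Suc n)" by metis
  have bound: "\<bar>HS_sum g F' N x z\<bar> \<le> B * K"
    if "\<And>x. \<bar>F' x\<bar> \<le> B" "fine_partition \<gamma> N x z" for F' B N x z \<gamma>
  proof -
    have "\<bar>HS_sum g F' N x z\<bar> \<le> B * (2 * M + variation g)"
      using HS_sum_bound[OF g that] .
    also have "\<dots> \<le> B * K" unfolding K_def using that(1)[of 0] by (intro mult_left_mono) auto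
    finally show ?thesis .
  qed
  have HS_diff: "HS_sum g (\<lambda>x. F1 x - F2 x) N x z = HS_sum g F1 N x z - HS_sum g F2 N x z" for F1 F2 N x z
    by (simp add: sum_subtractf[symmetric] algebra_simps)
  have dist: "\<bar>A m - A n\<bar> \<le> (1 / real (Suc m) + 1 / real (Suc n)) * K" for m n
  proof (rule has_HS_integral_close[OF sA sA])
    fix \<gamma> N x z assume p: "fine_partition \<gamma> N x z"
    have "\<bar>HS_sum g (\<lambda>x. s m x - s n x) N x z\<bar> \<le> (1 / real (Suc m) + 1 / real (Suc n)) * K"
    proof (rule bound[OF _ p])
      show "\<bar>s m x - s n x\<bar> \<le> 1 / real (Suc m) + 1 / real (Suc n)" for x
        using s[of x m] s[of x n] by linarith
    qed
    then show "\<bar>HS_sum g (s m) N x z - HS_sum g (s n) N x z\<bar> \<le> (1 / real (Suc m) + 1 / real (Suc n)) * K"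
      unfolding HS_diff .
  qed
  have lim0: "(\<lambda>n. 1 / real (Suc n)) \<longlonglongrightarrow> 0"
    using LIMSEQ_inverse_real_of_nat by (simp add: inverse_eq_divide)
  have "Cauchy A"
  proof (rule metric_CauchyI)
    fix e :: real assume "e > 0"
    have "\<forall>\<^sub>F n in sequentially. 1 / real (Suc n) < e / (2 * K)"
      using lim0 \<open>e > 0\<close> K by (intro order_tendstoD(2)) auto
    then obtain n0 where n0: "\<And>n. n \<ge> n0 \<Longrightarrow> 1 / real (Suc n) < e / (2 * K)"
      unfolding eventually_sequentially by blast
    have "dist (A m) (A n) < e" if "m \<ge> n0" "n \<ge> n0" for m n
    proof -
      have "(1 / real (Suc m) + 1 / real (Suc n)) * K < (e / (2 * K) + e / (2 * K)) * K"
        using n0[OF that(1)] n0[OF that(2)] K by (intro mult_strict_right_mono add_strict_mono) auto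
      also have "\<dots> = e" using K by (simp add: field_simps)
      finally show ?thesis using dist[of m n] by (simp add: dist_real_def)
    qed
    then show "\<exists>M. \<forall>m\<ge>M. \<forall>n\<ge>M. dist (A m) (A n) < e" by blast
  qed
  then obtain L where L: "A \<longlonglongrightarrow> L" using Cauchy_convergent convergent_def by blast
  have "has_HS_integral g F L"
    unfolding has_HS_integral_def
  proof (intro allI impI)
    fix e :: real assume e: "e > 0"
    have "\<forall>\<^sub>F n in sequentially. \<bar>A n - L\<bar> < e/3"
      using tendstoD[OF L, of "e/3"] e by (simp add: dist_real_def)
    moreover have "\<forall>\<^sub>F n in sequentially. 1 / real (Suc n) < e / (3 * K)"
      using lim0 \<open>e > 0\<close> K by (intro order_tendstoD(2)) auto
    ultimately have "\<forall>\<^sub>F n in sequentially. \<bar>A n - L\<bar> < e/3 \<and> 1 / real (Suc n) < e / (3 * K)"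
      by eventually_elim auto
    then obtain n where n: "\<bar>A n - L\<bar> < e/3" "1 / real (Suc n) < e / (3 * K)"
      unfolding eventually_sequentially by blast
    obtain \<gamma> where \<gamma>: "interval_gauge \<gamma>" "\<And>N x z. fine_partition \<gamma> N x z \<Longrightarrow> \<bar>HS_sum g (s n) N x z - A n\<bar> < e/3"
      using has_HS_integralD[OF sA[of n], of "e/3"] e by auto
    have "\<bar>HS_sum g F N x z - L\<bar> < e" if p: "fine_partition \<gamma> N x z" for N x z
    proof -
      have "\<bar>HS_sum g (\<lambda>x. F x - s n x) N x z\<bar> \<le> (1 / real (Suc n)) * K"
        by (rule bound[OF s p])
      also have "\<dots> < e / (3 * K) * K" using n K by (intro mult_strict_right_mono) auto
      also have "\<dots> = e/3" using K by simp
      finally show ?thesis unfolding HS_diff using \<gamma>(2)[OF p] n(1) by linarith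
    qed
    then show "\<exists>\<gamma>. interval_gauge \<gamma> \<and> (\<forall>N x z. fine_partition \<gamma> N x z \<longrightarrow> \<bar>HS_sum g F N x z - L\<bar> < e)"
      using \<gamma>(1) by blast
  qed
  then show ?thesis by blast
qed

section \<open>Left-continuous regulated functions and their step approximation\<close>

lemma left_lim_eqI: "((\<lambda>t. F (ereal t)) \<longlongrightarrow> l) (at_left x) \<Longrightarrow> left_lim F x = l"
  unfolding left_lim_def by (intro tendsto_Lim) auto

lemma right_lim_eqI: "((\<lambda>t. F (ereal t)) \<longlongrightarrow> l) (at_right x) \<Longrightarrow> right_lim F x = l"
  unfolding right_lim_def by (intro tendsto_Lim) auto

text \<open>A \<open>Lim\<close> term is informative only where the limit exists. Here existence and
  the equation for \<open>left_lim\<close> merge into convergence statements, the form used from now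
  on.\<close>

lemma B_r_iff:
  "F \<in> B_r \<longleftrightarrow> F (-\<infinity>) = 0 \<and>
     ((\<lambda>t. F (ereal t)) \<longlongrightarrow> F \<infinity>) at_top \<and> ((\<lambda>t. F (ereal t)) \<longlongrightarrow> 0) at_bot \<and>
     (\<forall>x. ((\<lambda>t. F (ereal t)) \<longlongrightarrow> F (ereal x)) (at_left x)) \<and>
     (\<forall>x. \<exists>l. ((\<lambda>t. F (ereal t)) \<longlongrightarrow> l) (at_right x))" (is "?L \<longleftrightarrow> ?R")
proof
  assume ?L
  then have F: "regulated F" "F (-\<infinity>) = 0" "\<And>x. F (ereal x) = left_lim F x"
    unfolding B_r_def by auto
  have "((\<lambda>t. F (ereal t)) \<longlongrightarrow> F (ereal x)) (at_left x)" for x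
  proof -
    obtain l where l: "((\<lambda>t. F (ereal t)) \<longlongrightarrow> l) (at_left x)" using F(1) unfolding regulated_def by blast
    then show ?thesis using left_lim_eqI[OF l] F(3)[of x] by simp
  qed
  then show ?R using F(1,2) unfolding regulated_def by auto
next
  assume R: ?R
  then have "F (ereal x) = left_lim F x" for x using left_lim_eqI[of F "F (ereal x)" x] by auto
  then show ?L using R unfolding B_r_def regulated_def by auto
qed

lemma B_r_diff: assumes "F \<in> B_r" "F' \<in> B_r" shows "F - F' \<in> B_r"
proof -
  have "\<exists>l. ((\<lambda>t. F (ereal t) - F' (ereal t)) \<longlongrightarrow> l) (at_right x)" for x
  proof -
    obtain l l' where "((\<lambda>t. F (ereal t)) \<longlongrightarrow> l) (at_right x)" "((\<lambda>t. F' (ereal t)) \<longlongrightarrow> l') (at_right x)"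
      using assms unfolding B_r_iff by metis
    then show ?thesis using tendsto_diff by blast
  qed
  moreover have "((\<lambda>t. F (ereal t) - F' (ereal t)) \<longlongrightarrow> 0 - 0) at_bot"
    using assms unfolding B_r_iff by (intro tendsto_diff) auto
  ultimately show ?thesis
    using assms unfolding B_r_iff by (auto intro!: tendsto_diff)
qed

text \<open>The two sides are treated differently. On the left \<open>F\<close> is close to
  \<open>F z\<close> itself, by left-continuity; on the right there is only a limit
  \<open>l\<close>, possibly different from \<open>F z\<close>, so points there are compared with
  each other, each within \<open>e/2\<close> of \<open>l\<close>.\<close>

lemma B_r_local_oscillation:
  assumes F: "F \<in> B_r" and e: "e > 0"
  shows "\<exists>U. open U \<and> z \<in> U \<and> (\<forall>a\<in>U. \<forall>b\<in>U. {a..b} \<subseteq> U) \<and>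
     (\<forall>x\<in>U. x \<le> z \<longrightarrow> \<bar>F x - F z\<bar> \<le> e) \<and> (\<forall>x\<in>U. \<forall>y\<in>U. z < x \<longrightarrow> z < y \<longrightarrow> \<bar>F x - F y\<bar> \<le> e)"
proof (cases z)
  case (real r)
  have "\<forall>\<^sub>F t in at_left r. dist (F (ereal t)) (F (ereal r)) < e"
    using F e unfolding B_r_iff by (intro tendstoD) auto
  then obtain u where u: "u < r" "\<And>t. u < t \<Longrightarrow> t < r \<Longrightarrow> \<bar>F (ereal t) - F (ereal r)\<bar> < e"
    unfolding eventually_at_left_field dist_real_def by blast
  obtain l where "((\<lambda>t. F (ereal t)) \<longlongrightarrow> l) (at_right r)" using F unfolding B_r_iff by blast
  then have "\<forall>\<^sub>F t in at_right r. dist (F (ereal t)) l < e/2" using e by (intro tendstoD) auto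
  then obtain v where v: "v > r" "\<And>t. r < t \<Longrightarrow> t < v \<Longrightarrow> \<bar>F (ereal t) - l\<bar> < e/2"
    unfolding eventually_at_right_field dist_real_def by blast
  show ?thesis
  proof (intro exI[of _ "{ereal u<..<ereal v}"] conjI ballI impI)
    fix x assume x: "x \<in> {ereal u<..<ereal v}" "x \<le> z"
    then obtain t where t: "x = ereal t" "u < t" "t \<le> r" using real by (cases x) auto
    show "\<bar>F x - F z\<bar> \<le> e"
      using u(2)[of t] t e real by (cases "t = r") auto
  next
    fix x y assume xy: "x \<in> {ereal u<..<ereal v}" "y \<in> {ereal u<..<ereal v}" "z < x" "z < y"
    obtain t where t: "x = ereal t" "r < t" "t < v" using xy real by (cases x) auto
    obtain t' where t': "y = ereal t'" "r < t'" "t' < v" using xy real by (cases y) auto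
    show "\<bar>F x - F y\<bar> \<le> e" using v(2)[OF t(2,3)] v(2)[OF t'(2,3)] unfolding t(1) t'(1) by linarith
  qed (use u v real in auto)
next
  case PInf
  have "\<forall>\<^sub>F t in at_top. dist (F (ereal t)) (F \<infinity>) < e"
    using F e unfolding B_r_iff by (intro tendstoD) auto
  then obtain u where u: "\<And>t. u \<le> t \<Longrightarrow> \<bar>F (ereal t) - F \<infinity>\<bar> < e"
    unfolding eventually_at_top_linorder dist_real_def by blast
  show ?thesis
  proof (intro exI[of _ "{ereal u<..}"] conjI ballI impI)
    fix x assume x: "x \<in> {ereal u<..}"
    show "\<bar>F x - F z\<bar> \<le> e"
      using u[of "real_of_ereal x"] x PInf e by (cases x) auto
  next
    fix x y assume xy: "x \<in> {ereal u<..}" "y \<in> {ereal u<..}"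
    have "ereal u < t" if "x \<le> t" for t using less_le_trans[OF _ that] xy by simp
    then show "{x..y} \<subseteq> {ereal u<..}" by auto
  qed (use PInf in auto)
next
  case MInf
  have "\<forall>\<^sub>F t in at_bot. dist (F (ereal t)) 0 < e/2"
    using F e unfolding B_r_iff by (intro tendstoD) auto
  then obtain v where v: "\<And>t. t \<le> v \<Longrightarrow> \<bar>F (ereal t)\<bar> < e/2"
    unfolding eventually_at_bot_linorder dist_real_def by auto
  have v': "\<bar>F x\<bar> \<le> e/2" if "x < ereal v" for x
    using v[of "real_of_ereal x"] that e F by (cases x) (auto simp: B_r_iff)
  show ?thesis
  proof (intro exI[of _ "{..<ereal v}"] conjI ballI impI)
    fix x y assume xy: "x \<in> {..<ereal v}" "y \<in> {..<ereal v}"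
    show "\<bar>F x - F y\<bar> \<le> e" using v'[of x] v'[of y] xy by simp
    have "t < ereal v" if "t \<le> y" for t using le_less_trans[OF that] xy by simp
    then show "{x..y} \<subseteq> {..<ereal v}" by auto
  next
    fix x assume "x \<le> z"
    then show "\<bar>F x - F z\<bar> \<le> e" using MInf e by simp
  qed (use MInf in auto)
qed

lemma B_r_step_approx:
  assumes F: "F \<in> B_r" and e: "e > 0"
  shows "\<exists>s\<in>step_functions. \<forall>x. \<bar>F x - s x\<bar> \<le> e"
proof -
  \<comment> \<open>Constancy from \<open>b\<close> on is part of the invariant because the height
    of the next jump has to be computed from a known value of \<open>s\<close>.\<close>
  let ?Q = "\<lambda>b. \<exists>s\<in>step_functions. (\<forall>x\<le>b. \<bar>F x - s x\<bar> \<le> e) \<and> (\<forall>x\<ge>b. s x = s b)"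
  have "?Q \<infinity>"
  proof (rule ereal_continuation[where Q = ?Q])
    have "F (-\<infinity>) = 0" using F by (simp add: B_r_iff)
    then show "?Q (-\<infinity>)" using e by (intro bexI[OF _ step_functions.zero]) simp
  next
    fix z
    obtain U where U: "open U" "z \<in> U" "\<forall>a\<in>U. \<forall>b\<in>U. {a..b} \<subseteq> U"
      and L: "\<forall>x\<in>U. x \<le> z \<longrightarrow> \<bar>F x - F z\<bar> \<le> e"
      and R: "\<forall>x\<in>U. \<forall>y\<in>U. z < x \<longrightarrow> z < y \<longrightarrow> \<bar>F x - F y\<bar> \<le> e"
      using B_r_local_oscillation[OF F e, of z] by (elim exE conjE)
    have "?Q b" if ab: "a \<in> U" "b \<in> U" "a \<le> z" "z \<le> b" "?Q a" for a b
    proof (cases "a = b")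
      case True
      then show ?thesis using ab(5) by simp
    next
      case False
      then have "a < b" using ab(3,4) by simp
      obtain s where s: "s \<in> step_functions" "\<And>x. x \<le> a \<Longrightarrow> \<bar>F x - s x\<bar> \<le> e" "\<And>x. a \<le> x \<Longrightarrow> s x = s a"
        using ab(5) by metis
      \<comment> \<open>The jump heights are chosen so that \<open>s'\<close> equals
        \<open>F z\<close> after \<open>a\<close> up to \<open>z\<close>, and \<open>F b\<close>
        after \<open>z\<close>. The two halves of the oscillation bound cover exactly these two
        ranges; if \<open>z = b\<close> the second jump has height 0.\<close>
      define s' where "s' = (\<lambda>x. s x + (F z - s a) * indicator {a<..} x + (F b - F z) * indicator {z<..} x)"
      have "s' \<in> step_functions"
        unfolding s'_def
        using step_functions.jump[of _ "F b - F z" z, OF step_functions.jump[of s "F z - s a" a, OF s(1)]] .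
      moreover have "\<bar>F x - s' x\<bar> \<le> e" if "x \<le> b" for x
      proof -
        consider "x \<le> a" | "a < x" "x \<le> z" | "a < x" "z < x" by fastforce
        then show ?thesis
        proof cases
          case 1
          then show ?thesis using s(2)[of x] ab(3) unfolding s'_def by (auto simp: indicator_def)
        next
          case 2
          then have "s' x = F z" unfolding s'_def using s(3)[of x] by (auto simp: indicator_def)
          moreover have "x \<in> U" using U(2,3) ab(1) 2 by fastforce
          ultimately show ?thesis using L 2 by auto
        next
          case 3
          then have "s' x = F b" unfolding s'_def using s(3)[of x] by (auto simp: indicator_def)
          moreover have "x \<in> U" using U(2,3) ab(2) 3 that by fastforce
          ultimately show ?thesis using R 3 that ab(2,4) by auto
        qed
      qed
      moreover have "s' x = s' b" if "x \<ge> b" for x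
      proof -
        have "s' y = F b" if "y \<ge> b" for y
        proof -
          have "a < y" using \<open>a < b\<close> that by (rule less_le_trans)
          then have y: "s' y = F z + (F b - F z) * indicator {z<..} y"
            unfolding s'_def using s(3)[of y] by simp
          show ?thesis
          proof (cases "z = b")
            case True
            then show ?thesis using y by simp
          next
            case False
            then have "z < y" using ab(4) that by simp
            then show ?thesis using y by simp
          qed
        qed
        then show ?thesis using that by simp
      qed
      ultimately show ?thesis by (intro bexI[of _ s'] conjI allI impI)
    qed
    then show "\<exists>U. open U \<and> z \<in> U \<and> (\<forall>a\<in>U. \<forall>b\<in>U. a \<le> z \<longrightarrow> z \<le> b \<longrightarrow> ?Q a \<longrightarrow> ?Q b)"
      by (intro exI[of _ U] conjI ballI impI U)
  qed
  then show ?thesis by auto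
qed

lemma step_functions_bounded: "s \<in> step_functions \<Longrightarrow> \<exists>K. \<forall>x. \<bar>s x\<bar> \<le> K"
proof (induction rule: step_functions.induct)
  case zero
  then show ?case by auto
next
  case (jump s c a)
  then obtain K where K: "\<And>x. \<bar>s x\<bar> \<le> K" by blast
  have "\<bar>s x + c * indicator {a<..} x\<bar> \<le> K + \<bar>c\<bar>" for x
    using K[of x] by (auto simp: indicator_def)
  then show ?case by (intro exI[of _ "K + \<bar>c\<bar>"] allI)
qed

lemma B_r_bounded: assumes "F \<in> B_r" shows "\<exists>K. \<forall>x. \<bar>F x\<bar> \<le> K"
proof -
  obtain s where s: "s \<in> step_functions" "\<And>x. \<bar>F x - s x\<bar> \<le> 1" using B_r_step_approx[OF assms, of 1] by (metis zero_less_one)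
  obtain K where K: "\<And>x. \<bar>s x\<bar> \<le> K" using step_functions_bounded[OF s(1)] by blast
  have "\<bar>F x\<bar> \<le> K + 1" for x using s(2)[of x] K[of x] by linarith
  then show ?thesis by (intro exI[of _ "K + 1"] allI)
qed

text \<open>The supremum in \<open>sup_norm\<close> runs over the reals only; the values at infinity
  are limits of real values and inherit the bound. Boundedness makes the supremum
  meaningful.\<close>

lemma abs_le_sup_norm:
  assumes bdd: "\<And>x. \<bar>F x\<bar> \<le> K"
    and lim: "((\<lambda>t. F (ereal t)) \<longlongrightarrow> F \<infinity>) at_top" "((\<lambda>t. F (ereal t)) \<longlongrightarrow> F (-\<infinity>)) at_bot"
  shows "\<bar>F x\<bar> \<le> sup_norm F"
proof -
  have r: "\<bar>F (ereal t)\<bar> \<le> sup_norm F" for t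
    unfolding sup_norm_def using bdd by (intro cSUP_upper) (auto intro!: bdd_aboveI)
  show ?thesis
  proof (cases x)
    case (real r)
    then show ?thesis using \<open>\<And>t. \<bar>F (ereal t)\<bar> \<le> sup_norm F\<close> by simp
  next
    case PInf
    then show ?thesis using r tendsto_upperbound[OF tendsto_rabs[OF lim(1)], of "sup_norm F"] by simp
  next
    case MInf
    then show ?thesis using r tendsto_upperbound[OF tendsto_rabs[OF lim(2)], of "sup_norm F"] by simp
  qed
qed

lemma B_r_sup_norm: assumes "F \<in> B_r" shows "\<bar>F x\<bar> \<le> sup_norm F"
proof -
  obtain K where K: "\<And>x. \<bar>F x\<bar> \<le> K" using B_r_bounded[OF assms] by blast
  show ?thesis by (rule abs_le_sup_norm[where F = F, OF K]) (use assms in \<open>auto simp: B_r_iff\<close>)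
qed

section \<open>Functions of bounded variation\<close>

lemma BV_bdd: "g \<in> BV \<Longrightarrow> bdd_above (variation_sums g)"
  by (simp add: BV_def)

lemma BV_bounded: assumes "g \<in> BV" shows "\<bar>g x\<bar> \<le> \<bar>g 0\<bar> + variation g"
  using diff_le_variation[OF BV_bdd[OF assms], of x 0] by linarith

lemma BV_sup_norm: assumes "g \<in> BV" shows "\<bar>g x\<bar> \<le> sup_norm g"
  by (rule abs_le_sup_norm[where F = g, OF BV_bounded[OF assms]]) (use assms in \<open>auto simp: BV_def\<close>)

lemma BV_diff: assumes "g \<in> BV" "g' \<in> BV" shows "g - g' \<in> BV"
proof -
  have "s \<le> variation g + variation g'" if s: "s \<in> variation_sums (g - g')" for s
  proof -
    obtain x N where N: "\<And>i. i < N \<Longrightarrow> x i < x (Suc i)"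
      and sum: "s = (\<Sum>i<N. \<bar>(g - g') (x (Suc i)) - (g - g') (x i)\<bar>)"
      using s unfolding variation_sums_def by blast
    have "s \<le> (\<Sum>i<N. \<bar>g (x (Suc i)) - g (x i)\<bar> + \<bar>g' (x (Suc i)) - g' (x i)\<bar>)"
      unfolding sum by (intro sum_mono) auto
    also have "\<dots> \<le> variation g + variation g'"
      unfolding sum.distrib using N
      by (intro add_mono variation_sum_le BV_bdd assms) (auto simp: less_imp_le)
    finally show ?thesis .
  qed
  then show ?thesis using assms unfolding BV_def by (auto intro!: tendsto_diff bdd_aboveI)
qed

section \<open>The integral as a bounded bilinear form\<close>

lemma HS_integrable:
  assumes g: "g \<in> BV" and F: "F \<in> B_r"
  shows "has_HS_integral g F (HS_integral g F)"
proof -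
  have "\<exists>A. has_HS_integral g F A"
  proof (rule has_HS_integral_uniform_limit[OF BV_bdd[OF g] BV_bounded[OF g]])
    fix e :: real assume "e > 0"
    then obtain s where s: "s \<in> step_functions" "\<forall>x. \<bar>F x - s x\<bar> \<le> e" using B_r_step_approx[OF F] by metis
    obtain A where "has_HS_integral g s A" using has_HS_integral_step[OF s(1), of g] by metis
    then show "\<exists>s A. has_HS_integral g s A \<and> (\<forall>x. \<bar>F x - s x\<bar> \<le> e)" using s(2) by metis
  qed
  then show ?thesis using HS_integral_eqI by auto
qed

lemma HS_integral_le:
  assumes g: "g \<in> BV" and F: "F \<in> B_r"
  shows "\<bar>HS_integral g F\<bar> \<le> 2 * sup_norm F * norm_BV g"
proof -
  have "\<bar>HS_integral g F\<bar> \<le> sup_norm F * (2 * sup_norm g + variation g)"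
    using HS_integral_bound[OF HS_integrable[OF assms] BV_bdd[OF g] BV_sup_norm[OF g] B_r_sup_norm[OF F]] .
  \<comment> \<open>Doubling the nonnegative \<open>variation g\<close> turns the bound into a
    multiple of the norm.\<close>
  also have "\<dots> \<le> sup_norm F * (2 * norm_BV g)"
    using B_r_sup_norm[OF F, of 0] variation_nonneg[OF BV_bdd[OF g]]
    unfolding norm_BV_def by (intro mult_left_mono) auto
  finally show ?thesis by simp
qed

lemma HS_integral_diff_integrand:
  "g \<in> BV \<Longrightarrow> g' \<in> BV \<Longrightarrow> F \<in> B_r \<Longrightarrow> HS_integral (g - g') F = HS_integral g F - HS_integral g' F"
  by (intro HS_integral_eqI has_HS_integral_diff_integrand HS_integrable)

lemma HS_integral_diff_integrator:
  "g \<in> BV \<Longrightarrow> F \<in> B_r \<Longrightarrow> F' \<in> B_r \<Longrightarrow> HS_integral g (F - F') = HS_integral g F - HS_integral g F'"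
  by (intro HS_integral_eqI has_HS_integral_diff_integrator HS_integrable)

text \<open>Continuity follows from
  \<open>\<integral>g' dF' - \<integral>g dF = \<integral>g d(F' - F) + \<integral>(g' - g) d(F' - F) + \<integral>(g' - g) dF\<close>.\<close>

lemma HS_integral_tendsto:
  assumes g: "g \<in> BV" "\<And>k. gs k \<in> BV" and F: "F \<in> B_r" "\<And>k. Fs k \<in> B_r"
    and lim: "(\<lambda>k. norm_BV (gs k - g)) \<longlonglongrightarrow> 0" "(\<lambda>k. sup_norm (Fs k - F)) \<longlonglongrightarrow> 0"
  shows "(\<lambda>k. HS_integral (gs k) (Fs k)) \<longlonglongrightarrow> HS_integral g F"
proof -
  have d: "gs k - g \<in> BV" and E: "Fs k - F \<in> B_r" for k
    using BV_diff B_r_diff g F by auto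
  let ?b = "\<lambda>k. 2 * sup_norm (Fs k - F) * norm_BV g +
    2 * sup_norm (Fs k - F) * norm_BV (gs k - g) + 2 * sup_norm F * norm_BV (gs k - g)"
  have "\<bar>HS_integral (gs k) (Fs k) - HS_integral g F\<bar> \<le> ?b k" for k
  proof -
    have "HS_integral (gs k) (Fs k) - HS_integral g F =
        HS_integral g (Fs k - F) + HS_integral (gs k - g) (Fs k - F) + HS_integral (gs k - g) F"
      using g F by (simp add: HS_integral_diff_integrand HS_integral_diff_integrator B_r_diff)
    then show ?thesis
      using HS_integral_le[OF g(1) E[of k]] HS_integral_le[OF d[of k] E[of k]]
        HS_integral_le[OF d[of k] F(1)] by linarith
  qed
  then have le: "norm (HS_integral (gs k) (Fs k) - HS_integral g F) \<le> ?b k" for k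
    unfolding real_norm_def .
  have "?b \<longlonglongrightarrow> 2 * 0 * norm_BV g + 2 * 0 * 0 + 2 * sup_norm F * 0"
    by (rule tendsto_add[OF tendsto_add]; (rule tendsto_mult[OF tendsto_mult])?; rule tendsto_const lim)
  then have b: "?b \<longlonglongrightarrow> 0" by (simp only: mult_zero_right mult_zero_left add_0)
  have "(\<lambda>k. HS_integral (gs k) (Fs k) - HS_integral g F) \<longlonglongrightarrow> 0"
    by (rule Lim_null_comparison[OF always_eventually b]) (rule allI, rule le)
  then show ?thesis by (rule LIM_zero_cancel)
qed

section \<open>Test functions\<close>

text \<open>Closure under differentiation replaces explicit formulas for higher derivatives: it
  suffices to place a function in some class that contains a derivative of each of its
  members.\<close>

lemma smooth_class:
  assumes S: "\<And>f. f \<in> S \<Longrightarrow> \<exists>f'\<in>S. \<forall>x::real. (f has_real_derivative f' x) (at x)" and "f \<in> S"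
  shows "(deriv ^^ k) f differentiable (at x)"
proof -
  have "(deriv ^^ k) f \<in> S"
  proof (induction k)
    case (Suc k)
    obtain f' where f': "f' \<in> S" "\<And>x. ((deriv ^^ k) f has_real_derivative f' x) (at x)"
      using S[OF Suc] by blast
    have "deriv ((deriv ^^ k) f) = f'" using f'(2) by (auto intro: DERIV_imp_deriv)
    then show ?case using f'(1) by simp
  qed (use \<open>f \<in> S\<close> in simp)
  then show ?thesis using S by (meson field_differentiable_imp_differentiable field_differentiable_def)
qed

lemma compact_support_iff:
  fixes \<phi> :: "real \<Rightarrow> real"
  shows "compact (closure {x. \<phi> x \<noteq> 0}) \<longleftrightarrow> (\<exists>R. \<forall>x. \<bar>x\<bar> > R \<longrightarrow> \<phi> x = 0)"
proof -
  have "compact (closure {x. \<phi> x \<noteq> 0}) \<longleftrightarrow> bounded {x. \<phi> x \<noteq> 0}" by (simp add: compact_closure)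
  also have "\<dots> \<longleftrightarrow> (\<exists>R. \<forall>x. \<bar>x\<bar> > R \<longrightarrow> \<phi> x = 0)"
    unfolding bounded_iff by (auto simp: not_le[symmetric])
  finally show ?thesis .
qed

lemma test_functionI:
  assumes "\<And>k x. (deriv ^^ k) \<phi> differentiable (at x)" "\<And>x. \<bar>x\<bar> > R \<Longrightarrow> \<phi> x = 0"
  shows "\<phi> \<in> test_functions"
  using assms compact_support_iff[of \<phi>] unfolding test_functions_def by auto

lemma test_function_support: "\<phi> \<in> test_functions \<Longrightarrow> \<exists>R. \<forall>x. \<bar>x\<bar> > R \<longrightarrow> \<phi> x = 0"
  using compact_support_iff[of \<phi>] unfolding test_functions_def by auto

lemma test_function_derivs:
  assumes "\<phi> \<in> test_functions"
  shows "((deriv ^^ k) \<phi> has_real_derivative (deriv ^^ Suc k) \<phi> x) (at x)"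
proof -
  have "(deriv ^^ k) \<phi> differentiable (at x)" using assms unfolding test_functions_def by blast
  then show ?thesis by (auto simp: real_differentiable_def DERIV_imp_deriv)
qed

lemma test_function_deriv: "\<phi> \<in> test_functions \<Longrightarrow> (\<phi> has_real_derivative deriv \<phi> x) (at x)"
  using test_function_derivs[of \<phi> 0 x] by simp

lemma test_function_continuous: "\<phi> \<in> test_functions \<Longrightarrow> continuous_on A \<phi>"
  by (meson DERIV_continuous_on has_field_derivative_at_within test_function_deriv)

lemma deriv_test_function:
  assumes \<phi>: "\<phi> \<in> test_functions" shows "deriv \<phi> \<in> test_functions"
proof -
  obtain R where R: "\<And>x. \<bar>x\<bar> > R \<Longrightarrow> \<phi> x = 0" using test_function_support[OF \<phi>] by blast
  show ?thesis
  proof (rule test_functionI)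
    show "(deriv ^^ k) (deriv \<phi>) differentiable (at x)" for k x
      using \<phi> unfolding test_functions_def funpow_Suc_right[symmetric, THEN fun_cong, unfolded comp_apply] by blast
    fix x :: real assume x: "\<bar>x\<bar> > R"
    have "open {x::real. \<bar>x\<bar> > R}" by (intro open_Collect_less continuous_intros)
    then have "\<forall>\<^sub>F y in nhds x. \<phi> y = 0" using x R by (auto simp: eventually_nhds)
    then have "deriv \<phi> x = deriv (\<lambda>x. 0) x" by (intro deriv_cong_ev) auto
    then show "deriv \<phi> x = 0" by simp
  qed
qed

text \<open>One argument for both cases needed later, the translate (\<open>d = 0\<close>) and the
  difference between a translate and the original (\<open>d = -1\<close>).\<close>

lemma test_function_lincomb_shift:
  assumes \<phi>: "\<phi> \<in> test_functions" and \<psi>: "\<psi> \<in> test_functions"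
  shows "(\<lambda>x. c * \<phi> (x + a) + d * \<psi> x) \<in> test_functions"
proof -
  obtain R where R: "\<And>x. \<bar>x\<bar> > R \<Longrightarrow> \<phi> x = 0" using test_function_support[OF \<phi>] by blast
  obtain R' where R': "\<And>x. \<bar>x\<bar> > R' \<Longrightarrow> \<psi> x = 0" using test_function_support[OF \<psi>] by blast
  show ?thesis
  proof (rule test_functionI)
    let ?S = "range (\<lambda>k x. c * (deriv ^^ k) \<phi> (x + a) + d * (deriv ^^ k) \<psi> x)"
    show "(deriv ^^ k) (\<lambda>x. c * \<phi> (x + a) + d * \<psi> x) differentiable (at x)" for k x
    proof (rule smooth_class[of ?S])
      fix f assume "f \<in> ?S"
      then obtain k where f: "f = (\<lambda>x. c * (deriv ^^ k) \<phi> (x + a) + d * (deriv ^^ k) \<psi> x)" by blast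
      have "(f has_real_derivative c * (deriv ^^ Suc k) \<phi> (x + a) + d * (deriv ^^ Suc k) \<psi> x) (at x)" for x
      proof -
        have "((\<lambda>x. (deriv ^^ k) \<phi> (x + a)) has_real_derivative (deriv ^^ Suc k) \<phi> (x + a)) (at x)"
          using test_function_derivs[OF \<phi>] by (intro DERIV_shift[THEN iffD1])
        then show ?thesis
          unfolding f using test_function_derivs[OF \<psi>]
          by (intro DERIV_add DERIV_cmult)
      qed
      then show "\<exists>f'\<in>?S. \<forall>x. (f has_real_derivative f' x) (at x)"
        by (intro bexI[of _ "\<lambda>x. c * (deriv ^^ Suc k) \<phi> (x + a) + d * (deriv ^^ Suc k) \<psi> x"]) blast+
    next
      have "(\<lambda>x. c * \<phi> (x + a) + d * \<psi> x) =
          (\<lambda>k x. c * (deriv ^^ k) \<phi> (x + a) + d * (deriv ^^ k) \<psi> x) 0" by simp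
      then show "(\<lambda>x. c * \<phi> (x + a) + d * \<psi> x) \<in> ?S" by blast
    qed
    show "c * \<phi> (x + a) + d * \<psi> x = 0" if "max (R + \<bar>a\<bar>) R' < \<bar>x\<bar>" for x
    proof -
      have "R < \<bar>x + a\<bar>" "R' < \<bar>x\<bar>" using that by linarith+
      then show ?thesis using R R' by simp
    qed
  qed
qed

lemma test_function_shift: "\<phi> \<in> test_functions \<Longrightarrow> (\<lambda>x. \<phi> (x + a)) \<in> test_functions"
  using test_function_lincomb_shift[of \<phi> \<phi> 1 a 0] by simp

lemma test_function_shift_diff: "\<phi> \<in> test_functions \<Longrightarrow> (\<lambda>x. \<phi> (x + a) - \<phi> x) \<in> test_functions"
  using test_function_lincomb_shift[of \<phi> \<phi> 1 a "-1"] by simp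

lemma deriv_shift_test_function:
  assumes "\<phi> \<in> test_functions" shows "deriv (\<lambda>x. \<phi> (x + a)) = (\<lambda>x. deriv \<phi> (x + a))"
  using test_function_deriv[OF assms] by (intro ext DERIV_imp_deriv DERIV_shift[THEN iffD1])

text \<open>The antiderivative at \<open>x\<close> is the integral of \<open>\<phi>\<close> over the
  window from \<open>x\<close> to \<open>x + a\<close>. Unlike an antiderivative \<open>P\<close> of
  \<open>\<phi>\<close>, it vanishes as soon as the window has left the support.\<close>

lemma test_function_shift_diff_antiderivative:
  assumes \<phi>: "\<phi> \<in> test_functions" and a: "a > 0"
  shows "\<exists>\<Phi>\<in>test_functions. deriv \<Phi> = (\<lambda>x. \<phi> (x + a) - \<phi> x)"
proof -
  obtain R where R: "\<And>x. \<bar>x\<bar> > R \<Longrightarrow> \<phi> x = 0" using test_function_support[OF \<phi>] by blast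
  obtain P where P: "\<And>x. (P has_real_derivative \<phi> x) (at x)"
  proof -
    have "\<And>x::real. -\<infinity> < ereal x \<Longrightarrow> ereal x < \<infinity> \<Longrightarrow> isCont \<phi> x"
      using test_function_deriv[OF \<phi>] DERIV_isCont by blast
    then have "\<exists>F. \<forall>x::real. -\<infinity> < ereal x \<longrightarrow> ereal x < \<infinity> \<longrightarrow> (F has_vector_derivative \<phi> x) (at x)"
      using einterval_antiderivative[of "-\<infinity>" \<infinity> \<phi>] by auto
    then show ?thesis using that by (auto simp: has_real_derivative_iff_has_vector_derivative)
  qed
  define \<Phi> where "\<Phi> x = P (x + a) - P x" for x
  have D: "(\<Phi> has_real_derivative \<phi> (x + a) - \<phi> x) (at x)" for x
    unfolding \<Phi>_def using P by (intro DERIV_diff DERIV_shift[THEN iffD1])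
  then have deriv: "deriv \<Phi> = (\<lambda>x. \<phi> (x + a) - \<phi> x)" by (intro ext DERIV_imp_deriv)
  have "\<Phi> \<in> test_functions"
  proof (rule test_functionI)
    show "(deriv ^^ k) \<Phi> differentiable (at x)" for k x
    proof (cases k)
      case 0
      then show ?thesis using D by (auto simp: real_differentiable_def)
    next
      case (Suc j)
      have "(deriv ^^ j) (\<lambda>x. \<phi> (x + a) - \<phi> x) differentiable (at x)"
        using test_function_shift_diff[OF \<phi>] unfolding test_functions_def by blast
      then show ?thesis unfolding Suc funpow_Suc_right by (simp add: deriv)
    qed
    fix x :: real assume x: "\<bar>x\<bar> > R + a"
    \<comment> \<open>For \<open>\<bar>x\<bar> > R + a\<close> the whole window lies where
      \<open>\<phi>\<close> vanishes, so the mean value theorem gives the value 0 without computing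
      an integral.\<close>
    obtain \<xi> where \<xi>: "x < \<xi>" "\<xi> < x + a" "P (x + a) - P x = (x + a - x) * \<phi> \<xi>"
      using MVT2[of x "x + a" P \<phi>] P a by auto
    have "\<phi> \<xi> = 0" using \<xi>(1,2) x a by (intro R) linarith
    then show "\<Phi> x = 0" using \<xi>(3) by (simp add: \<Phi>_def)
  qed
  then show ?thesis using deriv by blast
qed

section \<open>Smooth bump functions\<close>

definition flat_exp :: "nat \<Rightarrow> real \<Rightarrow> real" where
  "flat_exp k x = (if x > 0 then inverse x ^ k * exp (- inverse x) else 0)"

text \<open>Differentiating \<open>exp (- 1 / x)\<close> produces powers of \<open>1 / x\<close>.
  Indexing the family by these powers makes its linear span closed under differentiation, also at
  the origin.\<close>

lemma flat_exp_deriv: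
  "(flat_exp k has_real_derivative flat_exp (k + 2) x - real k * flat_exp (k + 1) x) (at x)"
proof -
  consider "x > 0" | "x < 0" | "x = 0" by linarith
  then show ?thesis
  proof cases
    case 1
    have "((\<lambda>x. inverse x ^ k * exp (- inverse x)) has_real_derivative
        flat_exp (k + 2) x - real k * flat_exp (k + 1) x) (at x)"
    proof -
      \<comment> \<open>The power rule yields the exponent \<open>k - 1\<close>; the factor
        \<open>real k\<close> makes the identity survive truncated subtraction at
        \<open>k = 0\<close>.\<close>
      have "real k * inverse x ^ (k - 1) = real k * (x * inverse x ^ k)"
        using 1 by (cases k) (auto simp: field_simps)
      then show ?thesis
        using 1 by (auto intro!: derivative_eq_intros simp: flat_exp_def)
    qed
    moreover have "\<forall>\<^sub>F y in nhds x. flat_exp k y = inverse y ^ k * exp (- inverse y)"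
      using eventually_nhds_in_open[of "{0<..}" x] 1 by (auto simp: flat_exp_def elim!: eventually_mono)
    ultimately show ?thesis by (subst DERIV_cong_ev[OF refl _ refl])
  next
    case 2
    have "\<forall>\<^sub>F y in nhds x. flat_exp k y = 0"
      using eventually_nhds_in_open[of "{..<0}" x] 2 by (auto simp: flat_exp_def elim!: eventually_mono)
    moreover have "((\<lambda>x. 0) has_real_derivative flat_exp (k + 2) x - real k * flat_exp (k + 1) x) (at x)"
      using 2 by (simp add: flat_exp_def)
    ultimately show ?thesis by (subst DERIV_cong_ev[OF refl _ refl])
  next
    case 3
    \<comment> \<open>With \<open>u = 1 / h\<close> the right difference quotient at 0 is
      \<open>u ^ (k + 1) / exp u\<close>, and the exponential wins as \<open>u\<close> tends to
      infinity.\<close>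
    have "((\<lambda>h::real. inverse h ^ (k + 1) / exp (inverse h)) \<longlongrightarrow> 0) (at_right 0)"
      using filterlim_compose[OF tendsto_power_div_exp_0 filterlim_inverse_at_top_right] .
    then have "((\<lambda>h. flat_exp k h / h) \<longlongrightarrow> 0) (at_right 0)"
      by (rule Lim_transform_eventually)
        (auto simp: eventually_at_right_field flat_exp_def exp_minus field_simps intro!: exI[of _ 1])
    moreover have "((\<lambda>h. flat_exp k h / h) \<longlongrightarrow> 0) (at_left 0)"
      by (rule Lim_transform_eventually[OF tendsto_const])
        (auto simp: eventually_at_left_field flat_exp_def intro!: exI[of _ "-1"])
    ultimately have "((\<lambda>h. flat_exp k h / h) \<longlongrightarrow> 0) (at 0)" by (simp add: filterlim_split_at)
    then show ?thesis unfolding has_field_derivative_iff 3 by (simp add: flat_exp_def)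
  qed
qed

text \<open>The product rule turns a product of two flat exponentials into a linear combination of
  such products; this class is built to be closed under it, as \<open>smooth_class\<close>
  demands.\<close>

inductive_set bump_class :: "real \<Rightarrow> real \<Rightarrow> (real \<Rightarrow> real) set" for a b where
  prod: "(\<lambda>x. flat_exp j (x - a) * flat_exp k (b - x)) \<in> bump_class a b"
| lin: "f \<in> bump_class a b \<Longrightarrow> g \<in> bump_class a b \<Longrightarrow> (\<lambda>x. c * f x + g x) \<in> bump_class a b"

lemma bump_class_deriv:
  "f \<in> bump_class a b \<Longrightarrow> \<exists>f'\<in>bump_class a b. \<forall>x. (f has_real_derivative f' x) (at x)"
proof (induction rule: bump_class.induct)
  case (prod j k)
  let ?p = "\<lambda>j k x. flat_exp j (x - a) * flat_exp k (b - x)"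
  let ?f' = "\<lambda>x. (- real j) * ?p (j + 1) k x + ((-1) * ?p j (k + 2) x + (real k * ?p j (k + 1) x + ?p (j + 2) k x))"
  have "?f' \<in> bump_class a b" by (intro bump_class.intros)
  moreover have "(?p j k has_real_derivative ?f' x) (at x)" for x
    by (rule derivative_eq_intros DERIV_chain2[OF flat_exp_deriv] refl)+ (simp add: algebra_simps)
  ultimately show ?case by (intro bexI[of _ ?f'] allI)
next
  case (lin f g c)
  then obtain f' g' where fg: "f' \<in> bump_class a b" "g' \<in> bump_class a b"
    "\<And>x. (f has_real_derivative f' x) (at x)" "\<And>x. (g has_real_derivative g' x) (at x)" by blast
  then have "((\<lambda>x. c * f x + g x) has_real_derivative c * f' x + g' x) (at x)" for x
    by (intro DERIV_add DERIV_cmult)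
  then show ?case using bump_class.lin[OF fg(1,2), of c] by (intro bexI[of _ "\<lambda>x. c * f' x + g' x"] allI)
qed

lemma flat_exp_nonneg: "flat_exp k x \<ge> 0" and flat_exp_pos_iff: "flat_exp 0 x > 0 \<longleftrightarrow> x > 0"
  by (auto simp: flat_exp_def)

text \<open>The first factor is positive exactly to the right of \<open>a\<close>, the second
  exactly to the left of \<open>b\<close>. For \<open>a \<ge> b\<close> the product is identically
  0.\<close>

lemma bump_exists:
  "\<exists>\<phi>\<in>test_functions. \<forall>x. \<phi> x \<ge> 0 \<and> (\<phi> x > 0 \<longleftrightarrow> a < x \<and> x < b)"
proof -
  let ?\<phi> = "\<lambda>x. flat_exp 0 (x - a) * flat_exp 0 (b - x)"
  have "?\<phi> \<in> test_functions"
  proof (rule test_functionI)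
    show "(deriv ^^ k) ?\<phi> differentiable (at x)" for k x
      by (rule smooth_class[of "bump_class a b"]) (auto intro: bump_class_deriv bump_class.prod)
    show "?\<phi> x = 0" if "max \<bar>a\<bar> \<bar>b\<bar> < \<bar>x\<bar>" for x
      using that by (auto simp: flat_exp_def)
  qed
  moreover have "\<forall>x. ?\<phi> x \<ge> 0 \<and> (?\<phi> x > 0 \<longleftrightarrow> a < x \<and> x < b)"
  proof (intro allI conjI)
    fix x
    show "?\<phi> x \<ge> 0" by (intro mult_nonneg_nonneg flat_exp_nonneg)
    show "?\<phi> x > 0 \<longleftrightarrow> a < x \<and> x < b"
      using flat_exp_nonneg[of 0 "x - a"] flat_exp_pos_iff[of "x - a"] flat_exp_pos_iff[of "b - x"]
      by (auto simp: zero_less_mult_iff)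
  qed
  ultimately show ?thesis by (intro bexI[of _ ?\<phi>])
qed

section \<open>Uniqueness of primitives\<close>

text \<open>A functional that vanishes at \<open>-\<infinity>\<close>, that is, on \<open>\<phi>(\<cdot> + a)\<close> in the limit \<open>a \<rightarrow> \<infinity>\<close>, is determined
  by its derivative, because \<open>\<phi>(\<cdot> + a) - \<phi>\<close> is the derivative of a test function.\<close>

definition shift_additive :: "((real \<Rightarrow> real) \<Rightarrow> real) \<Rightarrow> bool" where
  "shift_additive T \<longleftrightarrow> (\<forall>\<phi>\<in>test_functions. \<forall>a. T (\<lambda>x. \<phi> (x + a) - \<phi> x) = T (\<lambda>x. \<phi> (x + a)) - T \<phi>)"

definition vanishes_at_bot :: "((real \<Rightarrow> real) \<Rightarrow> real) \<Rightarrow> bool" where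
  "vanishes_at_bot T \<longleftrightarrow> (\<forall>\<phi>\<in>test_functions. ((\<lambda>a. T (\<lambda>x. \<phi> (x + a))) \<longlongrightarrow> 0) at_top)"

lemma distr_deriv_eq_0D:
  assumes T: "shift_additive T" "vanishes_at_bot T"
    and 0: "\<And>\<phi>. \<phi> \<in> test_functions \<Longrightarrow> distr_deriv T \<phi> = 0" and \<phi>: "\<phi> \<in> test_functions"
  shows "T \<phi> = 0"
proof -
  have const: "T (\<lambda>x. \<phi> (x + a)) = T \<phi>" if a: "a > 0" for a
  proof -
    obtain \<Phi> where \<Phi>: "\<Phi> \<in> test_functions" "deriv \<Phi> = (\<lambda>x. \<phi> (x + a) - \<phi> x)"
      using test_function_shift_diff_antiderivative[OF \<phi> a] by metis
    have "T (\<lambda>x. \<phi> (x + a) - \<phi> x) = 0" using 0[OF \<Phi>(1)] \<Phi> by (simp add: distr_deriv_def)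
    then show ?thesis using T(1) \<phi> unfolding shift_additive_def by simp
  qed
  have "\<forall>\<^sub>F a in at_top. T (\<lambda>x. \<phi> (x + a)) = T \<phi>"
    using eventually_gt_at_top[of 0] by eventually_elim (rule const)
  then have "((\<lambda>a::real. T \<phi>) \<longlongrightarrow> 0) at_top"
    using T(2) \<phi> unfolding vanishes_at_bot_def by (auto elim: Lim_transform_eventually)
  then show ?thesis by (simp add: tendsto_const_iff)
qed

lemma distr_deriv_shift_additive:
  assumes "shift_additive T" shows "shift_additive (distr_deriv T)"
  unfolding shift_additive_def
proof (intro ballI allI)
  fix \<phi> :: "real \<Rightarrow> real" and a assume \<phi>: "\<phi> \<in> test_functions"
  have "deriv (\<lambda>x. \<phi> (x + a) - \<phi> x) = (\<lambda>x. deriv \<phi> (x + a) - deriv \<phi> x)"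
    using test_function_deriv[OF \<phi>] by (intro ext DERIV_imp_deriv DERIV_diff DERIV_shift[THEN iffD1])
  then show "distr_deriv T (\<lambda>x. \<phi> (x + a) - \<phi> x) = distr_deriv T (\<lambda>x. \<phi> (x + a)) - distr_deriv T \<phi>"
    using assms deriv_test_function[OF \<phi>] test_function_shift[OF \<phi>] test_function_shift_diff[OF \<phi>] \<phi>
    unfolding shift_additive_def distr_deriv_def by (simp add: deriv_shift_test_function)
qed

lemma distr_deriv_vanishes_at_bot:
  assumes "vanishes_at_bot T" shows "vanishes_at_bot (distr_deriv T)"
  unfolding vanishes_at_bot_def
proof
  fix \<phi> :: "real \<Rightarrow> real" assume \<phi>: "\<phi> \<in> test_functions"
  have "((\<lambda>a. - T (\<lambda>x. deriv \<phi> (x + a))) \<longlongrightarrow> - 0) at_top"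
    using assms deriv_test_function[OF \<phi>] unfolding vanishes_at_bot_def by (intro tendsto_minus) simp
  then show "((\<lambda>a. distr_deriv T (\<lambda>x. \<phi> (x + a))) \<longlongrightarrow> 0) at_top"
    using \<phi> test_function_shift[OF \<phi>] by (simp add: distr_deriv_def deriv_shift_test_function)
qed

text \<open>The induction peels off the innermost derivative: the hypothesis for \<open>n\<close>,
  applied to \<open>distr_deriv T\<close>, shows that this vanishes, and one more step removes the
  last derivative. This works because both properties of \<open>T\<close> pass to
  \<open>distr_deriv T\<close>.\<close>

lemma iterated_distr_deriv_eq_0D:
  assumes "shift_additive T" "vanishes_at_bot T"
    and "\<And>\<phi>. \<phi> \<in> test_functions \<Longrightarrow> (distr_deriv ^^ n) T \<phi> = 0" and "\<phi> \<in> test_functions"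
  shows "T \<phi> = 0"
  using assms
proof (induction n arbitrary: T \<phi>)
  case (Suc n)
  have "distr_deriv T \<psi> = 0" if "\<psi> \<in> test_functions" for \<psi>
  proof (rule Suc.IH[OF _ _ _ that])
    show "shift_additive (distr_deriv T)" "vanishes_at_bot (distr_deriv T)"
      using Suc.prems distr_deriv_shift_additive distr_deriv_vanishes_at_bot by auto
    show "(distr_deriv ^^ n) (distr_deriv T) \<phi> = 0" if "\<phi> \<in> test_functions" for \<phi>
      using Suc.prems(3)[OF that] by (simp add: funpow_swap1)
  qed
  then show ?case using distr_deriv_eq_0D Suc.prems by blast
qed simp

text \<open>A left-continuous function is the limit of its values at the points \<open>(\<lceil>m x\<rceil> - 1) / m\<close>.\<close>

lemma left_continuous_borel_measurable:
  fixes G :: "real \<Rightarrow> real"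
  assumes "\<And>x. (G \<longlongrightarrow> G x) (at_left x)"
  shows "G \<in> borel_measurable borel"
proof (rule borel_measurable_LIMSEQ_real)
  \<comment> \<open>Subtracting 1 from the ceiling keeps the points strictly below \<open>x\<close>
    even when the scaled \<open>x\<close> is an integer, as a left limit requires.
    \<open>Suc m\<close> avoids a zero denominator.\<close>
  let ?t = "\<lambda>m x. (real_of_int \<lceil>real (Suc m) * x\<rceil> - 1) / real (Suc m)"
  show "(\<lambda>x. G (?t m x)) \<in> borel_measurable borel" for m
  proof -
    \<comment> \<open>Factoring through the integers makes \<open>G\<close> harmless: every function
      on a counting space is measurable.\<close>
    have "(\<lambda>x. (\<lambda>k::int. G ((real_of_int k - 1) / real (Suc m))) \<lceil>real (Suc m) * x\<rceil>) \<in> borel_measurable borel"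
      by (rule measurable_compose[of _ _ "count_space UNIV"]) measurable
    then show ?thesis .
  qed
  fix x :: real
  define t where "t m = ?t m x" for m
  have less: "t m < x" for m
    unfolding t_def using ceiling_correct[of "real (Suc m) * x"] by (simp add: field_simps)
  have ge: "x - 1 / real (Suc m) \<le> t m" for m
  proof -
    have "x - 1 / real (Suc m) = (real (Suc m) * x - 1) / real (Suc m)"
      by (simp add: diff_divide_distrib del: of_nat_Suc)
    also have "\<dots> \<le> t m" unfolding t_def by (intro divide_right_mono diff_right_mono le_of_int_ceiling) simp
    finally show ?thesis .
  qed
  have "(\<lambda>m. 1 / real (Suc m)) \<longlonglongrightarrow> 0"
    using LIMSEQ_inverse_real_of_nat by (simp add: inverse_eq_divide)
  from tendsto_diff[OF tendsto_const[of x] this]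
  have lim: "(\<lambda>m. x - 1 / real (Suc m)) \<longlonglongrightarrow> x" by simp
  have "t \<longlonglongrightarrow> x"
  proof (rule tendsto_sandwich[OF _ _ lim tendsto_const[of x]])
    show "\<forall>\<^sub>F m in sequentially. x - 1 / real (Suc m) \<le> t m" by (intro always_eventually allI ge)
    show "\<forall>\<^sub>F m in sequentially. t m \<le> x" by (intro always_eventually allI less_imp_le less)
  qed
  moreover have "\<forall>\<^sub>F m in sequentially. t m \<in> {..<x} \<and> t m \<noteq> x"
    using less less_imp_neq[OF less] by (intro always_eventually allI conjI) auto
  ultimately have "filterlim t (at_left x) sequentially"
    unfolding filterlim_at by (intro conjI)
  from filterlim_compose[OF assms this] show "(\<lambda>m. G (?t m x)) \<longlonglongrightarrow> G x" unfolding t_def .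
qed

section \<open>Regular distributions generated by left-continuous functions\<close>

lemma B_r_borel_measurable: "F \<in> B_r \<Longrightarrow> (\<lambda>x. F (ereal x)) \<in> borel_measurable borel"
  by (rule left_continuous_borel_measurable) (simp add: B_r_iff)

lemma test_function_borel_measurable: "\<phi> \<in> test_functions \<Longrightarrow> \<phi> \<in> borel_measurable borel"
  by (intro borel_measurable_continuous_onI test_function_continuous)

lemma test_function_dominated:
  assumes "\<phi> \<in> test_functions" shows "\<exists>M R. \<forall>x. \<bar>\<phi> x\<bar> \<le> M * indicator {-R..R} x"
proof -
  obtain R where R: "\<And>x. \<bar>x\<bar> > R \<Longrightarrow> \<phi> x = 0" using test_function_support[OF assms] by metis
  have "compact (\<phi> ` {-R..R})" using assms by (intro compact_continuous_image test_function_continuous) auto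
  from compact_imp_bounded[OF this] obtain M where M: "\<And>x. x \<in> {-R..R} \<Longrightarrow> \<bar>\<phi> x\<bar> \<le> M"
    unfolding bounded_iff by (metis imageI real_norm_def)
  have "\<bar>\<phi> x\<bar> \<le> M * indicator {-R..R} x" for x
    using R[of x] M[of x] by (cases "x \<in> {-R..R}") auto
  then show ?thesis by (intro exI allI)
qed

lemma integrable_mult_test_function:
  assumes G: "G \<in> borel_measurable borel" "\<And>x. \<bar>G x\<bar> \<le> K" and \<phi>: "\<phi> \<in> test_functions"
  shows "integrable lborel (\<lambda>x. G x * \<phi> x :: real)"
proof -
  obtain M R where MR: "\<And>x. \<bar>\<phi> x\<bar> \<le> M * indicator {-R..R} x" using test_function_dominated[OF \<phi>] by metis
  show ?thesis
  proof (rule Bochner_Integration.integrable_bound)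
    show "integrable lborel (\<lambda>x. K * (M * indicator {-R..R} x :: real))"
      by (intro integrable_mult_right integrable_real_indicator) (simp_all add: emeasure_lborel_Icc_eq)
    show "(\<lambda>x. G x * \<phi> x) \<in> borel_measurable lborel"
      using G(1) test_function_borel_measurable[OF \<phi>] by measurable
    have "norm (G x * \<phi> x) \<le> norm (K * (M * indicator {-R..R} x))" for x
    proof -
      have "\<bar>G x\<bar> * \<bar>\<phi> x\<bar> \<le> K * (M * indicator {-R..R} x)"
        using order_trans[OF abs_ge_zero G(2)[of x]] by (intro mult_mono G(2) MR) auto
      then show ?thesis unfolding real_norm_def abs_mult[of "G x"] by linarith
    qed
    then show "AE x in lborel. norm (G x * \<phi> x) \<le> norm (K * (M * indicator {-R..R} x))" by simp
  qed
qed

lemma integrable_B_r_test_function: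
  assumes "F \<in> B_r" "\<phi> \<in> test_functions" shows "integrable lborel (\<lambda>x. F (ereal x) * \<phi> x)"
  using integrable_mult_test_function[of "\<lambda>x. F (ereal x)", OF B_r_borel_measurable[OF assms(1)] B_r_sup_norm[OF assms(1)] assms(2)] .

lemma regular_distribution_shift_additive:
  assumes F: "F \<in> B_r" shows "shift_additive (regular_distribution (\<lambda>x. F (ereal x)))"
  unfolding shift_additive_def
proof (intro ballI allI)
  fix \<phi> :: "real \<Rightarrow> real" and a assume \<phi>: "\<phi> \<in> test_functions"
  show "regular_distribution (\<lambda>x. F (ereal x)) (\<lambda>x. \<phi> (x + a) - \<phi> x) =
      regular_distribution (\<lambda>x. F (ereal x)) (\<lambda>x. \<phi> (x + a)) - regular_distribution (\<lambda>x. F (ereal x)) \<phi>"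
    using integrable_B_r_test_function[OF F] \<phi> test_function_shift[OF \<phi>] test_function_shift_diff[OF \<phi>]
    by (simp add: regular_distribution_def right_diff_distrib Bochner_Integration.integral_diff)
qed

text \<open>Translating \<open>\<phi>\<close> by \<open>a\<close> amounts to evaluating
  \<open>F\<close> at \<open>x - a\<close>, which tends to the limit 0 of \<open>F\<close> at
  \<open>-\<infinity>\<close>. After this change of variable the support stays fixed and
  \<open>F\<close> is bounded, so dominated convergence applies.\<close>

lemma regular_distribution_vanishes_at_bot:
  assumes F: "F \<in> B_r" shows "vanishes_at_bot (regular_distribution (\<lambda>x. F (ereal x)))"
  unfolding vanishes_at_bot_def
proof
  fix \<phi> :: "real \<Rightarrow> real" assume \<phi>: "\<phi> \<in> test_functions"
  note [measurable] = B_r_borel_measurable[OF F] test_function_borel_measurable[OF \<phi>]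
  have shift: "(LBINT x. F (ereal x) * \<phi> (x + a)) = (LBINT x. F (ereal (x - a)) * \<phi> x)" for a
    using lborel_integral_real_affine[of 1 "\<lambda>x. F (ereal x) * \<phi> (x + a)" "- a"]
    by (simp add: algebra_simps)
  obtain M R where MR: "\<And>x. \<bar>\<phi> x\<bar> \<le> M * indicator {-R..R} x" using test_function_dominated[OF \<phi>] by metis
  have "((\<lambda>a. LBINT x. F (ereal (x - a)) * \<phi> x) \<longlongrightarrow> (LBINT x::real. 0)) at_top"
  proof (rule integral_dominated_convergence_at_top)
    show "integrable lborel (\<lambda>x. sup_norm F * (M * indicator {-R..R} x :: real))"
      by (intro integrable_mult_right integrable_real_indicator) (simp_all add: emeasure_lborel_Icc_eq)
    have "norm (F (ereal (x - a)) * \<phi> x) \<le> sup_norm F * (M * indicator {-R..R} x)" for x a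
      unfolding real_norm_def abs_mult
      using order_trans[OF abs_ge_zero B_r_sup_norm[OF F, of 0]] by (intro mult_mono B_r_sup_norm F MR) auto
    then show "\<forall>\<^sub>F a in at_top. AE x in lborel. norm (F (ereal (x - a)) * \<phi> x) \<le> sup_norm F * (M * indicator {-R..R} x)"
      by simp
    have "((\<lambda>a. F (ereal (x - a)) * \<phi> x) \<longlongrightarrow> 0) at_top" for x
    proof -
      have "filterlim (\<lambda>a. x - a) at_bot at_top"
        unfolding filterlim_at_bot
      proof
        fix Z show "\<forall>\<^sub>F a in at_top. x - a \<le> Z"
          using eventually_ge_at_top[of "x - Z"] by eventually_elim simp
      qed
      then have "((\<lambda>a. F (ereal (x - a))) \<longlongrightarrow> 0) at_top"
        using filterlim_compose[of "\<lambda>t. F (ereal t)"] F unfolding B_r_iff by metis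
      then show ?thesis by (rule tendsto_mult_left_zero)
    qed
    then show "AE x in lborel. ((\<lambda>a. F (ereal (x - a)) * \<phi> x) \<longlongrightarrow> 0) at_top" by simp
  qed (simp_all)
  then show "((\<lambda>a. regular_distribution (\<lambda>x. F (ereal x)) (\<lambda>x. \<phi> (x + a))) \<longlongrightarrow> 0) at_top"
    using test_function_shift[OF \<phi>] by (simp add: regular_distribution_def shift)
qed

text \<open>Left-continuity spreads a positive value at \<open>x\<close> over an interval
  \<open>{u<..<x}\<close>, and a bump positive exactly there would give a positive integral.\<close>

lemma B_r_nonpos:
  assumes F: "F \<in> B_r" and 0: "\<And>\<phi>. \<phi> \<in> test_functions \<Longrightarrow> (LBINT x. F (ereal x) * \<phi> x) = 0"
  shows "F (ereal x) \<le> 0"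
proof (rule ccontr)
  assume "\<not> F (ereal x) \<le> 0"
  then have "\<forall>\<^sub>F t in at_left x. F (ereal t) > 0"
    using F unfolding B_r_iff by (intro order_tendstoD(1)[of _ "F (ereal x)"]) auto
  then obtain u where u: "u < x" "\<And>t. u < t \<Longrightarrow> t < x \<Longrightarrow> F (ereal t) > 0"
    unfolding eventually_at_left_field by metis
  obtain \<phi> where \<phi>: "\<phi> \<in> test_functions" "\<And>t. \<phi> t \<ge> 0" "\<And>t. \<phi> t > 0 \<longleftrightarrow> u < t \<and> t < x"
    using bump_exists[of u x] by metis
  have out: "\<phi> t = 0" if "\<not> (u < t \<and> t < x)" for t using \<phi>(2)[of t] \<phi>(3)[of t] that by simp
  have nonneg: "F (ereal t) * \<phi> t \<ge> 0" for t
  proof (cases "u < t \<and> t < x")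
    case True
    then show ?thesis using u(2)[of t] \<phi>(2)[of t] by simp
  next
    case False
    then show ?thesis using out[of t] by simp
  qed
  have "AE t in lborel. F (ereal t) * \<phi> t = 0"
    using integral_nonneg_eq_0_iff_AE[OF integrable_B_r_test_function[OF F \<phi>(1)]] nonneg 0[OF \<phi>(1)] by simp
  then have "AE t in lborel. t \<notin> {u<..<x}"
  proof eventually_elim
    case (elim t)
    show ?case
    proof
      assume "t \<in> {u<..<x}"
      then have "F (ereal t) > 0" "\<phi> t > 0" using u(2) \<phi>(3) by auto
      then show False using elim by simp
    qed
  qed
  then have "emeasure lborel {u<..<x} = 0" by (subst (asm) AE_iff_measurable[of "{u<..<x}"]) auto
  then show False using u(1) by simp
qed

text \<open>The sign argument applies to \<open>F\<close> and to its negative, and it gives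
  vanishing at every real rather than almost everywhere. The values at infinity follow as a limit
  and by the normalisation \<open>F (-\<infinity>) = 0\<close>.\<close>

lemma B_r_eqI:
  assumes F: "F \<in> B_r" and 0: "\<And>\<phi>. \<phi> \<in> test_functions \<Longrightarrow> (LBINT x. F (ereal x) * \<phi> x) = 0"
  shows "F = (\<lambda>x. 0)"
proof -
  have "(\<lambda>x. 0) - F \<in> B_r" using F by (intro B_r_diff) (auto simp: B_r_iff)
  moreover have "(LBINT x. ((\<lambda>x. 0) - F) (ereal x) * \<phi> x) = 0" if "\<phi> \<in> test_functions" for \<phi>
    using 0[OF that] by simp
  ultimately have "((\<lambda>x. 0) - F) (ereal x) \<le> 0" for x by (rule B_r_nonpos)
  then have r: "F (ereal x) = 0" for x using B_r_nonpos[OF F 0, of x] by (simp add: antisym)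
  then have "F \<infinity> = 0" using F unfolding B_r_iff by (simp add: tendsto_const_iff)
  moreover have "F (-\<infinity>) = 0" using F by (simp add: B_r_iff)
  ultimately have "F x = 0" for x using r by (cases x) auto
  then show ?thesis by (intro ext)
qed

section \<open>Additivity and uniqueness of the primitive\<close>

lemma distr_deriv_diff: "distr_deriv (S - T) = distr_deriv S - distr_deriv T"
  by (auto simp: distr_deriv_def)

lemma iterated_distr_deriv_diff: "(distr_deriv ^^ n) (S - T) = (distr_deriv ^^ n) S - (distr_deriv ^^ n) T"
  by (induction n) (simp_all only: funpow.simps id_apply comp_apply distr_deriv_diff)

lemma is_primitive_diff:
  assumes "is_primitive n f F" "is_primitive n f' F'"
  shows "is_primitive n (f - f') (F - F')"
proof -
  have F: "F \<in> B_r" "F' \<in> B_r" using assms by (auto simp: is_primitive_def)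
  have "regular_distribution (\<lambda>x. (F - F') (ereal x)) =
      regular_distribution (\<lambda>x. F (ereal x)) - regular_distribution (\<lambda>x. F' (ereal x))"
    using integrable_B_r_test_function[OF F(1)] integrable_B_r_test_function[OF F(2)]
    by (auto simp: regular_distribution_def left_diff_distrib Bochner_Integration.integral_diff)
  then show ?thesis
    using assms B_r_diff[OF F] by (simp add: is_primitive_def iterated_distr_deriv_diff)
qed

text \<open>The difference of two primitives is again in \<open>B_r\<close> and is a primitive of
  \<open>f - f\<close>, the zero functional; undoing the derivatives and then testing against bumps
  makes it zero.\<close>

lemma is_primitive_unique:
  assumes "is_primitive n f F" "is_primitive n f F'" shows "F = F'"
proof -
  have D: "F - F' \<in> B_r"
    and "(distr_deriv ^^ n) (regular_distribution (\<lambda>x. (F - F') (ereal x))) = f - f"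
    using is_primitive_diff[OF assms] by (auto simp only: is_primitive_def)
  then have "(distr_deriv ^^ n) (regular_distribution (\<lambda>x. (F - F') (ereal x))) \<phi> = 0" for \<phi> by simp
  then have "regular_distribution (\<lambda>x. (F - F') (ereal x)) \<phi> = 0" if "\<phi> \<in> test_functions" for \<phi>
    using iterated_distr_deriv_eq_0D[OF regular_distribution_shift_additive[OF D]
        regular_distribution_vanishes_at_bot[OF D] _ that] by metis
  then have "(LBINT x. (F - F') (ereal x) * \<phi> x) = 0" if "\<phi> \<in> test_functions" for \<phi>
    using that by (simp add: regular_distribution_def)
  from fun_cong[OF B_r_eqI[OF D this]] have "F x = F' x" for x by simp
  then show ?thesis by (rule ext)
qed

lemma primitive_eqI: "is_primitive n f F \<Longrightarrow> primitive n f = F"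
  unfolding primitive_def by (rule the_equality) (auto dest: is_primitive_unique)

lemma is_primitive_primitive: "f \<in> A_r n \<Longrightarrow> is_primitive n f (primitive n f)"
  using primitive_eqI by (auto simp: A_r_def)

lemma primitive_B_r: "f \<in> A_r n \<Longrightarrow> primitive n f \<in> B_r"
  using is_primitive_primitive by (auto simp: is_primitive_def)

text \<open>By uniqueness it is enough to exhibit one primitive of \<open>f - f'\<close>. This
  identifies \<open>norm_a n (f - f')\<close> with the sup norm of the difference of the
  primitives.\<close>

lemma primitive_diff: "f \<in> A_r n \<Longrightarrow> f' \<in> A_r n \<Longrightarrow> primitive n (f - f') = primitive n f - primitive n f'"
  by (intro primitive_eqI is_primitive_diff is_primitive_primitive)

section \<open>Normalisation of functions of bounded variation\<close>

text \<open>The total variation on \<open>{-\<infinity>..b}\<close>. Chains are only weakly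
  increasing, so that endpoints can be appended without case distinctions.\<close>

definition variation_up_to :: "(ereal \<Rightarrow> real) \<Rightarrow> ereal \<Rightarrow> real" where
  "variation_up_to g b = Sup {(\<Sum>i<N. \<bar>g (x (Suc i)) - g (x i)\<bar>) | (x :: nat \<Rightarrow> ereal) N.
     (\<forall>i<N. x i \<le> x (Suc i)) \<and> x N \<le> b}"

lemma variation_up_to_upper:
  assumes "g \<in> BV" "\<And>i. i < N \<Longrightarrow> x i \<le> x (Suc i)" "x N \<le> b"
  shows "(\<Sum>i<N. \<bar>g (x (Suc i)) - g (x i)\<bar>) \<le> variation_up_to g b"
  unfolding variation_up_to_def
proof (rule cSup_upper)
  show "bdd_above {(\<Sum>i<N. \<bar>g (x (Suc i)) - g (x i)\<bar>) | (x :: nat \<Rightarrow> ereal) N.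
     (\<forall>i<N. x i \<le> x (Suc i)) \<and> x N \<le> b}"
    by (rule bdd_aboveI[of _ "variation g"]) (auto intro!: variation_sum_le BV_bdd assms)
qed (use assms in auto)

text \<open>A chain ending at or below \<open>a\<close> is prolonged by \<open>a\<close> and then
  \<open>b\<close>; the extra term from its last point to \<open>a\<close> is nonnegative and is
  discarded.\<close>

lemma variation_up_to_add:
  assumes g: "g \<in> BV" and "a \<le> b"
  shows "variation_up_to g a + \<bar>g b - g a\<bar> \<le> variation_up_to g b"
proof -
  have "variation_up_to g a \<le> variation_up_to g b - \<bar>g b - g a\<bar>"
    unfolding variation_up_to_def[of g a]
  proof (rule cSup_least)
    have "0 \<in> {(\<Sum>i<N. \<bar>g (x (Suc i)) - g (x i)\<bar>) | (x :: nat \<Rightarrow> ereal) N.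
        (\<forall>i<N. x i \<le> x (Suc i)) \<and> x N \<le> a}"
      by (auto intro!: exI[of _ "\<lambda>_. a"] exI[of _ 0])
    then show "{(\<Sum>i<N. \<bar>g (x (Suc i)) - g (x i)\<bar>) | (x :: nat \<Rightarrow> ereal) N.
        (\<forall>i<N. x i \<le> x (Suc i)) \<and> x N \<le> a} \<noteq> {}" by (metis empty_iff)
  next
    fix s assume "s \<in> {(\<Sum>i<N. \<bar>g (x (Suc i)) - g (x i)\<bar>) | (x :: nat \<Rightarrow> ereal) N.
        (\<forall>i<N. x i \<le> x (Suc i)) \<and> x N \<le> a}"
    then obtain x :: "nat \<Rightarrow> ereal" and N where x: "\<forall>i<N. x i \<le> x (Suc i)" "x N \<le> a"
      and s: "s = (\<Sum>i<N. \<bar>g (x (Suc i)) - g (x i)\<bar>)" by auto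
    define y where "y i = (if i \<le> N then x i else if i = Suc N then a else b)" for i
    have "(\<Sum>i<Suc (Suc N). \<bar>g (y (Suc i)) - g (y i)\<bar>) \<le> variation_up_to g b"
      by (rule variation_up_to_upper[OF g]) (use x \<open>a \<le> b\<close> in \<open>auto simp: y_def not_le less_Suc_eq\<close>)
    moreover have "(\<Sum>i<N. \<bar>g (y (Suc i)) - g (y i)\<bar>) = s"
      unfolding s by (intro sum.cong) (auto simp: y_def)
    ultimately have "s + \<bar>g (y (Suc N)) - g (y N)\<bar> + \<bar>g (y (Suc (Suc N))) - g (y (Suc N))\<bar> \<le> variation_up_to g b"
      by simp
    then have "s + \<bar>g b - g a\<bar> \<le> variation_up_to g b"
      using abs_ge_zero[of "g a - g (x N)"] by (simp add: y_def)
    then show "s \<le> variation_up_to g b - \<bar>g b - g a\<bar>" by simp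
  qed
  then show ?thesis by simp
qed

text \<open>The Jordan decomposition. It reduces one-sided limits, measurability, countability of
  discontinuities and the effect of normalisation to monotone functions.\<close>

lemma BV_mono_decomposition:
  assumes g: "g \<in> BV"
  shows "\<exists>p q :: ereal \<Rightarrow> real. mono p \<and> mono q \<and> g = p - q"
proof (intro exI conjI)
  show "mono (variation_up_to g)"
    using variation_up_to_add[OF g] by (intro monoI) (smt (verit) abs_ge_zero)
  show "mono (variation_up_to g - g)"
    using variation_up_to_add[OF g] by (intro monoI) (smt (verit) abs_ge_self fun_diff_def)
  show "g = variation_up_to g - (variation_up_to g - g)" by (simp add: fun_eq_iff)
qed

text \<open>The increments of \<open>p\<close> and \<open>q\<close> telescope, and their totals are
  bounded by the real values that both functions take at the two infinities.\<close>

lemma mono_diff_bdd_variation: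
  assumes p: "mono p" and q: "mono q"
  shows "bdd_above (variation_sums (p - q))"
proof (rule bdd_aboveI)
  fix s assume "s \<in> variation_sums (p - q)"
  then obtain x N where x: "\<forall>i<N. x i < x (Suc i)"
    and s: "s = (\<Sum>i<N. \<bar>(p - q) (x (Suc i)) - (p - q) (x i)\<bar>)"
    unfolding variation_sums_def by auto
  have "s \<le> (\<Sum>i<N. (p (x (Suc i)) - p (x i)) + (q (x (Suc i)) - q (x i)))"
    unfolding s
  proof (rule sum_mono)
    fix i assume "i \<in> {..<N}"
    then have "x i \<le> x (Suc i)" using x by (simp add: less_imp_le)
    then show "\<bar>(p - q) (x (Suc i)) - (p - q) (x i)\<bar> \<le> (p (x (Suc i)) - p (x i)) + (q (x (Suc i)) - q (x i))"
      using monoD[OF p] monoD[OF q] by (simp add: abs_le_iff)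
  qed
  also have "\<dots> = (p (x N) - p (x 0)) + (q (x N) - q (x 0))"
    by (simp add: sum.distrib sum_lessThan_telescope[of "\<lambda>i. p (x i)"] sum_lessThan_telescope[of "\<lambda>i. q (x i)"])
  also have "\<dots> \<le> (p \<infinity> - p (-\<infinity>)) + (q \<infinity> - q (-\<infinity>))"
    by (intro add_mono diff_mono monoD[OF p] monoD[OF q]) auto
  finally show "s \<le> (p \<infinity> - p (-\<infinity>)) + (q \<infinity> - q (-\<infinity>))" .
qed

section \<open>One-sided limits and discontinuities\<close>

lemma mono_left_limit:
  fixes f :: "real \<Rightarrow> real"
  assumes f: "mono f" shows "(f \<longlongrightarrow> Sup (f ` {..<x})) (at_left x)"
proof (rule order_tendstoI)
  have bdd: "bdd_above (f ` {..<x})"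
    by (rule bdd_aboveI[of _ "f x"]) (auto intro: monoD[OF f])
  {
    fix a assume "a < Sup (f ` {..<x})"
    then obtain u where u: "u < x" "a < f u"
      using less_cSup_iff[OF _ bdd, of a] by auto
    have "a < f t" if "u < t" for t using u(2) monoD[OF f, of u t] that by simp
    then show "\<forall>\<^sub>F t in at_left x. a < f t"
      unfolding eventually_at_left_field using u(1) by auto
  next
    fix a assume a: "Sup (f ` {..<x}) < a"
    have "f t < a" if "t < x" for t
      using cSup_upper[OF _ bdd, of "f t"] that a by fastforce
    then show "\<forall>\<^sub>F t in at_left x. f t < a"
      unfolding eventually_at_left_field by (auto intro: exI[of _ "x - 1"])
  }
qed

lemma mono_right_limit:
  fixes f :: "real \<Rightarrow> real"
  assumes f: "mono f" shows "(f \<longlongrightarrow> Inf (f ` {x<..})) (at_right x)"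
proof (rule order_tendstoI)
  have bdd: "bdd_below (f ` {x<..})"
    by (rule bdd_belowI[of _ "f x"]) (auto intro: monoD[OF f])
  {
    fix a assume "Inf (f ` {x<..}) < a"
    then obtain u where u: "x < u" "f u < a"
      using cInf_less_iff[OF _ bdd, of a] by auto
    have "f t < a" if "t < u" for t using u(2) monoD[OF f, of t u] that by simp
    then show "\<forall>\<^sub>F t in at_right x. f t < a"
      unfolding eventually_at_right_field using u(1) by auto
  next
    fix a assume a: "a < Inf (f ` {x<..})"
    have "a < f t" if "x < t" for t
      using cInf_lower[OF _ bdd, of "f t"] that a by fastforce
    then show "\<forall>\<^sub>F t in at_right x. a < f t"
      unfolding eventually_at_right_field by (auto intro: exI[of _ "x + 1"])
  }
qed

lemma mono_ereal: "mono p \<Longrightarrow> mono (\<lambda>t::real. p (ereal t))"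
  by (auto simp: mono_def)

lemma mono_left_lim:
  fixes p :: "ereal \<Rightarrow> real"
  assumes "mono p" shows "((\<lambda>t. p (ereal t)) \<longlongrightarrow> left_lim p x) (at_left x)"
  using mono_left_limit[OF mono_ereal[OF assms], of x] left_lim_eqI by metis

lemma mono_right_lim:
  fixes p :: "ereal \<Rightarrow> real"
  assumes "mono p" shows "((\<lambda>t. p (ereal t)) \<longlongrightarrow> right_lim p x) (at_right x)"
  using mono_right_limit[OF mono_ereal[OF assms], of x] right_lim_eqI by metis

lemma BV_one_sided_limits:
  assumes "g \<in> BV"
  shows BV_left_lim: "((\<lambda>t. g (ereal t)) \<longlongrightarrow> left_lim g x) (at_left x)"
    and BV_right_lim: "((\<lambda>t. g (ereal t)) \<longlongrightarrow> right_lim g x) (at_right x)"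
proof -
  obtain p q where pq: "mono p" "mono q" "g = p - q" using BV_mono_decomposition[OF assms] by metis
  have "((\<lambda>t. g (ereal t)) \<longlongrightarrow> left_lim p x - left_lim q x) (at_left x)"
    using tendsto_diff[OF mono_left_lim[OF pq(1)] mono_left_lim[OF pq(2)]] by (simp add: pq(3))
  then show "((\<lambda>t. g (ereal t)) \<longlongrightarrow> left_lim g x) (at_left x)" using left_lim_eqI by metis
  have "((\<lambda>t. g (ereal t)) \<longlongrightarrow> right_lim p x - right_lim q x) (at_right x)"
    using tendsto_diff[OF mono_right_lim[OF pq(1)] mono_right_lim[OF pq(2)]] by (simp add: pq(3))
  then show "((\<lambda>t. g (ereal t)) \<longlongrightarrow> right_lim g x) (at_right x)" using right_lim_eqI by metis
qed

lemma BV_countable_discontinuities: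
  assumes "g \<in> BV" shows "countable {t::real. \<not> isCont (\<lambda>t. g (ereal t)) t}"
proof -
  obtain p q where pq: "mono p" "mono q" "g = p - q" using BV_mono_decomposition[OF assms] by metis
  have "{t::real. \<not> isCont (\<lambda>t. g (ereal t)) t} \<subseteq>
      {t. \<not> isCont (\<lambda>t. p (ereal t)) t} \<union> {t. \<not> isCont (\<lambda>t. q (ereal t)) t}"
    unfolding pq(3) by (auto intro: continuous_diff)
  then show ?thesis
    using mono_ctble_discont[OF mono_ereal[OF pq(1)]] mono_ctble_discont[OF mono_ereal[OF pq(2)]]
    by (metis countable_Un countable_subset)
qed

lemma BV_borel_measurable:
  assumes "g \<in> BV" shows "(\<lambda>t. g (ereal t)) \<in> borel_measurable borel"
proof -
  obtain p q where pq: "mono p" "mono q" "g = p - q" using BV_mono_decomposition[OF assms] by metis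
  show ?thesis
    unfolding pq(3) fun_diff_def
    by (intro borel_measurable_diff borel_measurable_mono mono_ereal pq)
qed

text \<open>The values at infinity are kept: \<open>BV\<close> already ties them to the limits, and
  the averaging condition of \<open>NBV\<close> concerns real points only.\<close>

definition normalisation :: "real \<Rightarrow> (ereal \<Rightarrow> real) \<Rightarrow> ereal \<Rightarrow> real" where
  "normalisation lam g x =
     (if \<bar>x\<bar> = \<infinity> then g x
      else (1 - lam) * left_lim g (real_of_ereal x) + lam * right_lim g (real_of_ereal x))"

lemma normalisation_ereal [simp]:
  "normalisation lam g (ereal t) = (1 - lam) * left_lim g t + lam * right_lim g t"
  by (simp add: normalisation_def)

lemma normalisation_infinity [simp]:
  "normalisation lam g \<infinity> = g \<infinity>" "normalisation lam g (-\<infinity>) = g (-\<infinity>)"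
  by (simp_all add: normalisation_def)

text \<open>\<open>left_lim\<close> and \<open>right_lim\<close> are \<open>Lim\<close> terms and
  subtract only once the limits exist, which monotonicity guarantees.\<close>

lemma normalisation_diff:
  assumes p: "mono p" and q: "mono q"
  shows "normalisation lam (p - q) = normalisation lam p - normalisation lam q"
proof
  fix x
  have L: "left_lim (p - q) t = left_lim p t - left_lim q t" for t
    using tendsto_diff[OF mono_left_lim[OF p] mono_left_lim[OF q], of t] by (intro left_lim_eqI) simp
  have R: "right_lim (p - q) t = right_lim p t - right_lim q t" for t
    using tendsto_diff[OF mono_right_lim[OF p] mono_right_lim[OF q], of t] by (intro right_lim_eqI) simp
  show "normalisation lam (p - q) x = (normalisation lam p - normalisation lam q) x"
    by (cases x) (simp_all add: L R right_diff_distrib)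
qed

lemma mono_lim_bounds:
  fixes p :: "ereal \<Rightarrow> real"
  assumes p: "mono p"
  shows "s < t \<Longrightarrow> p (ereal s) \<le> left_lim p t" "left_lim p t \<le> p (ereal t)"
    "p (ereal t) \<le> right_lim p t" "t < s \<Longrightarrow> right_lim p t \<le> p (ereal s)"
proof -
  show "p (ereal s) \<le> left_lim p t" if "s < t"
  proof (rule tendsto_lowerbound[OF mono_left_lim[OF p]])
    show "\<forall>\<^sub>F u in at_left t. p (ereal s) \<le> p (ereal u)"
      unfolding eventually_at_left_field using that by (auto intro!: exI[of _ s] monoD[OF p])
  qed simp
  show "left_lim p t \<le> p (ereal t)"
  proof (rule tendsto_upperbound[OF mono_left_lim[OF p]])
    show "\<forall>\<^sub>F u in at_left t. p (ereal u) \<le> p (ereal t)"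
      unfolding eventually_at_left_field by (auto intro!: exI[of _ "t - 1"] monoD[OF p])
  qed simp
  show "p (ereal t) \<le> right_lim p t"
  proof (rule tendsto_lowerbound[OF mono_right_lim[OF p]])
    show "\<forall>\<^sub>F u in at_right t. p (ereal t) \<le> p (ereal u)"
      unfolding eventually_at_right_field by (auto intro!: exI[of _ "t + 1"] monoD[OF p])
  qed simp
  show "right_lim p t \<le> p (ereal s)" if "t < s"
  proof (rule tendsto_upperbound[OF mono_right_lim[OF p]])
    show "\<forall>\<^sub>F u in at_right t. p (ereal u) \<le> p (ereal s)"
      unfolding eventually_at_right_field using that by (auto intro!: exI[of _ s] monoD[OF p])
  qed simp
qed

lemma convex_combination_bounds:
  fixes a b l u lam :: real
  assumes "0 \<le> lam" "lam \<le> 1" "l \<le> a" "l \<le> b" "a \<le> u" "b \<le> u"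
  shows "l \<le> (1 - lam) * a + lam * b" "(1 - lam) * a + lam * b \<le> u"
proof -
  have "(1 - lam) * l + lam * l \<le> (1 - lam) * a + lam * b"
    using assms by (intro add_mono mult_left_mono) auto
  then show "l \<le> (1 - lam) * a + lam * b" by (simp add: algebra_simps)
  have "(1 - lam) * a + lam * b \<le> (1 - lam) * u + lam * u"
    using assms by (intro add_mono mult_left_mono) auto
  then show "(1 - lam) * a + lam * b \<le> u" by (simp add: algebra_simps)
qed

text \<open>A convex combination stays between the one-sided limits. For \<open>s < t\<close> any
  point \<open>m\<close> strictly between them separates the normalised values: the one at
  \<open>s\<close> is at most \<open>p m\<close>, which is at most the one at
  \<open>t\<close>.\<close>

lemma mono_normalisation:
  assumes p: "mono p" and lam: "0 \<le> lam" "lam \<le> 1"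
  shows "mono (normalisation lam p)"
proof -
  note b = mono_lim_bounds[OF p]
  have lr: "left_lim p t \<le> right_lim p t" for t
    using order_trans[OF b(2) b(3)] .
  have up: "normalisation lam p (ereal t) \<le> p (ereal s)" if "t < s" for s t
    unfolding normalisation_ereal
    by (rule convex_combination_bounds(2)[OF lam order_refl lr order_trans[OF lr b(4)[OF that]] b(4)[OF that]])
  have lo: "p (ereal s) \<le> normalisation lam p (ereal t)" if "s < t" for s t
    unfolding normalisation_ereal
    by (rule convex_combination_bounds(1)[OF lam b(1)[OF that] order_trans[OF b(1)[OF that] lr] lr order_refl])
  show ?thesis
  proof (rule monoI)
    fix x y :: ereal assume "x \<le> y"
    consider "x = y" | s t where "x = ereal s" "y = ereal t" "s < t" | "x = -\<infinity>" "y = \<infinity>"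
      | t where "x = -\<infinity>" "y = ereal t" | t where "x = ereal t" "y = \<infinity>"
      using \<open>x \<le> y\<close> by (cases x; cases y) (auto simp: le_less)
    then show "normalisation lam p x \<le> normalisation lam p y"
    proof cases
      case 1
      then show ?thesis by simp
    next
      case 2
      obtain m where "s < m" "m < t" using dense[OF 2(3)] by auto
      then show ?thesis using up[of s m] lo[of m t] 2 by simp
    next
      case 3
      then show ?thesis using monoD[OF p, of "-\<infinity>" \<infinity>] by simp
    next
      case 4
      then show ?thesis using monoD[OF p, of "-\<infinity>" "ereal (t - 1)"] lo[of "t - 1" t] by simp
    next
      case 5
      then show ?thesis using monoD[OF p, of "ereal (t + 1)" \<infinity>] up[of t "t + 1"] by simp
    qed
  qed
qed

text \<open>The hypothesis on \<open>A\<close> holds for the one-sided neighbourhood filters of a point and for those of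
  \<open>\<plusminus>\<infinity>\<close>: all of them have a base of open intervals.\<close>

lemma normalisation_tendsto:
  assumes g: "g \<in> BV" and lam: "0 \<le> lam" "lam \<le> 1"
    and A: "\<And>P. eventually P A \<Longrightarrow> \<forall>\<^sub>F t in A. eventually P (at_left t) \<and> eventually P (at_right t)"
    and lim: "((\<lambda>t. g (ereal t)) \<longlongrightarrow> l) A"
  shows "((\<lambda>t. normalisation lam g (ereal t)) \<longlongrightarrow> l) A"
proof (rule tendstoI)
  fix e :: real assume e: "e > 0"
  then have "e/2 > 0" by simp
  \<comment> \<open>The inequalities are made weak, with \<open>e/2\<close>, so that they pass to
    the one-sided limits of \<open>g\<close>; the slack restores the strict bound by
    \<open>e\<close>.\<close>
  from tendstoD[OF lim this] have "\<forall>\<^sub>F t in A. l - e/2 \<le> g (ereal t) \<and> g (ereal t) \<le> l + e/2"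
    by eventually_elim (simp only: dist_real_def, intro conjI; linarith)
  from A[OF this] show "\<forall>\<^sub>F t in A. dist (normalisation lam g (ereal t)) l < e"
  proof eventually_elim
    case (elim t)
    have L: "l - e/2 \<le> left_lim g t" "left_lim g t \<le> l + e/2"
      using elim by (auto intro!: tendsto_lowerbound[OF BV_left_lim[OF g]] tendsto_upperbound[OF BV_left_lim[OF g]]
          elim: eventually_mono)
    have R: "l - e/2 \<le> right_lim g t" "right_lim g t \<le> l + e/2"
      using elim by (auto intro!: tendsto_lowerbound[OF BV_right_lim[OF g]] tendsto_upperbound[OF BV_right_lim[OF g]]
          elim: eventually_mono)
    show ?case
      using convex_combination_bounds[OF lam L(1) R(1) L(2) R(2)] e
      by (simp add: dist_real_def abs_less_iff)
  qed
qed

lemma eventually_one_sided: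
  fixes P :: "real \<Rightarrow> bool"
  assumes "\<And>t. u < t \<Longrightarrow> t < v \<Longrightarrow> P t" "u < x" "x < v"
  shows "eventually P (at_left x) \<and> eventually P (at_right x)"
  unfolding eventually_at_left_field eventually_at_right_field using assms by (meson less_trans)

text \<open>The condition in \<open>NBV\<close> refers to the one-sided limits of the normalised
  function itself, so these must be shown to agree with those of \<open>g\<close>. Bounded variation
  comes from the Jordan parts, which stay monotone.\<close>

lemma normalisation_NBV:
  assumes g: "g \<in> BV" and lam: "0 \<le> lam" "lam \<le> 1"
  shows "normalisation lam g \<in> NBV lam"
proof -
  obtain p q where pq: "mono p" "mono q" "g = p - q" using BV_mono_decomposition[OF g] by metis
  have bdd: "bdd_above (variation_sums (normalisation lam g))"
    unfolding pq(3) normalisation_diff[OF pq(1,2)]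
    by (intro mono_diff_bdd_variation mono_normalisation pq lam)
  have top: "((\<lambda>t. normalisation lam g (ereal t)) \<longlongrightarrow> g \<infinity>) at_top"
  proof (rule normalisation_tendsto[OF g lam])
    fix P :: "real \<Rightarrow> bool" assume "eventually P at_top"
    then obtain N where N: "\<And>t. t > N \<Longrightarrow> P t" unfolding eventually_at_top_dense by metis
    show "\<forall>\<^sub>F t in at_top. eventually P (at_left t) \<and> eventually P (at_right t)"
      using eventually_gt_at_top[of N]
    proof eventually_elim
      case (elim t)
      show ?case by (rule eventually_one_sided[of N "t + 1" P]) (use N elim in auto)
    qed
  qed (use g in \<open>simp add: BV_def\<close>)
  have bot: "((\<lambda>t. normalisation lam g (ereal t)) \<longlongrightarrow> g (-\<infinity>)) at_bot"
  proof (rule normalisation_tendsto[OF g lam])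
    fix P :: "real \<Rightarrow> bool" assume "eventually P at_bot"
    then obtain N where N: "\<And>t. t < N \<Longrightarrow> P t" unfolding eventually_at_bot_dense by metis
    show "\<forall>\<^sub>F t in at_bot. eventually P (at_left t) \<and> eventually P (at_right t)"
      using eventually_gt_at_bot[of N]
    proof eventually_elim
      case (elim t)
      show ?case by (rule eventually_one_sided[of "t - 1" N P]) (use N elim in auto)
    qed
  qed (use g in \<open>simp add: BV_def\<close>)
  have left: "left_lim (normalisation lam g) x = left_lim g x" for x
  proof (rule left_lim_eqI, rule normalisation_tendsto[OF g lam _ BV_left_lim[OF g]])
    fix P :: "real \<Rightarrow> bool" assume "eventually P (at_left x)"
    then obtain u where u: "u < x" "\<And>t. u < t \<Longrightarrow> t < x \<Longrightarrow> P t" unfolding eventually_at_left_field by metis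
    have "eventually P (at_left t) \<and> eventually P (at_right t)" if "u < t" "t < x" for t
      using eventually_one_sided[of u x P, OF u(2) that] .
    then show "\<forall>\<^sub>F t in at_left x. eventually P (at_left t) \<and> eventually P (at_right t)"
      unfolding eventually_at_left_field[of _ x] using u(1) by metis
  qed
  have right: "right_lim (normalisation lam g) x = right_lim g x" for x
  proof (rule right_lim_eqI, rule normalisation_tendsto[OF g lam _ BV_right_lim[OF g]])
    fix P :: "real \<Rightarrow> bool" assume "eventually P (at_right x)"
    then obtain u where u: "x < u" "\<And>t. x < t \<Longrightarrow> t < u \<Longrightarrow> P t" unfolding eventually_at_right_field by metis
    have "eventually P (at_left t) \<and> eventually P (at_right t)" if "x < t" "t < u" for t
      using eventually_one_sided[of x u P, OF u(2) that] .
    then show "\<forall>\<^sub>F t in at_right x. eventually P (at_left t) \<and> eventually P (at_right t)"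
      unfolding eventually_at_right_field[of _ x] using u(1) by metis
  qed
  show ?thesis unfolding NBV_def BV_def using bdd top bot left right by simp
qed

lemma normalisation_isCont:
  assumes "isCont (\<lambda>t. g (ereal t)) t" shows "normalisation lam g (ereal t) = g (ereal t)"
proof -
  have "((\<lambda>t. g (ereal t)) \<longlongrightarrow> g (ereal t)) (at t)" using assms by (simp add: isCont_def)
  then have "left_lim g t = g (ereal t)" "right_lim g t = g (ereal t)"
    by (auto intro!: left_lim_eqI right_lim_eqI simp: filterlim_at_split)
  then show ?thesis by (simp add: algebra_simps)
qed

lemma NBV_BV: "g \<in> NBV lam \<Longrightarrow> g \<in> BV"
  by (simp add: NBV_def)

lemma NBV_diff: assumes g: "g \<in> NBV lam" and g': "g' \<in> NBV lam" shows "g - g' \<in> NBV lam"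
proof -
  note BV = NBV_BV[OF g] NBV_BV[OF g']
  have L: "left_lim (g - g') t = left_lim g t - left_lim g' t" for t
    using tendsto_diff[OF BV_left_lim[OF BV(1)] BV_left_lim[OF BV(2)], of t] by (intro left_lim_eqI) simp
  have R: "right_lim (g - g') t = right_lim g t - right_lim g' t" for t
    using tendsto_diff[OF BV_right_lim[OF BV(1)] BV_right_lim[OF BV(2)], of t] by (intro right_lim_eqI) simp
  have "g (ereal t) = (1 - lam) * left_lim g t + lam * right_lim g t"
    "g' (ereal t) = (1 - lam) * left_lim g' t + lam * right_lim g' t" for t
    using g g' by (simp_all only: NBV_def mem_Collect_eq)
  then have "(g - g') (ereal t) = (1 - lam) * left_lim (g - g') t + lam * right_lim (g - g') t" for t
    unfolding L R by (simp add: right_diff_distrib)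
  then show ?thesis using BV_diff[OF BV] unfolding NBV_def by simp
qed

text \<open>All but countably many points are continuity points, so zeros are dense and no one-sided
  limit can differ from 0. The averaging condition then settles the real points, and limits settle
  the infinite ones.\<close>

lemma NBV_eq_0:
  assumes g: "g \<in> NBV lam" and 0: "\<And>t. isCont (\<lambda>t. g (ereal t)) t \<Longrightarrow> g (ereal t) = 0"
  shows "g x = 0"
proof -
  have countable: "countable {t. g (ereal t) \<noteq> 0}"
    by (rule countable_subset[OF _ BV_countable_discontinuities[OF NBV_BV[OF g]]]) (use 0 in auto)
  have dense: "\<exists>t. u < t \<and> t < v \<and> g (ereal t) = 0" if "u < v" for u v
  proof (rule ccontr)
    assume "\<nexists>t. u < t \<and> t < v \<and> g (ereal t) = 0"
    then have "{u<..<v} \<subseteq> {t. g (ereal t) \<noteq> 0}" by auto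
    then have "countable {u<..<v}" using countable countable_subset by metis
    then show False using uncountable_open_interval[of u v] that by simp
  qed
  have left: "left_lim g t = 0" for t
  proof (rule ccontr)
    assume "left_lim g t \<noteq> 0"
    from tendsto_imp_eventually_ne[OF BV_left_lim[OF NBV_BV[OF g]] this]
    obtain u where "u < t" "\<And>s. u < s \<Longrightarrow> s < t \<Longrightarrow> g (ereal s) \<noteq> 0"
      unfolding eventually_at_left_field by metis
    then show False using dense by metis
  qed
  have right: "right_lim g t = 0" for t
  proof (rule ccontr)
    assume "right_lim g t \<noteq> 0"
    from tendsto_imp_eventually_ne[OF BV_right_lim[OF NBV_BV[OF g]] this]
    obtain u where "t < u" "\<And>s. t < s \<Longrightarrow> s < u \<Longrightarrow> g (ereal s) \<noteq> 0"
      unfolding eventually_at_right_field by metis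
    then show False using dense by metis
  qed
  have real: "g (ereal t) = 0" for t using g left right unfolding NBV_def by simp
  moreover have "g \<infinity> = 0" "g (-\<infinity>) = 0"
    using NBV_BV[OF g] unfolding BV_def by (simp_all add: real tendsto_const_iff)
  ultimately show ?thesis by (cases x) auto
qed

section \<open>Iterated integrals\<close>

definition locally_integrable :: "(real \<Rightarrow> real) \<Rightarrow> bool" where
  "locally_integrable f \<longleftrightarrow> (\<forall>a b. set_integrable lborel {a..b} f)"

lemma locally_integrable_interval:
  assumes "locally_integrable f" shows "interval_lebesgue_integrable lborel (ereal a) (ereal b) f"
proof -
  have "set_integrable lborel {u<..<v} f" for u v
    by (rule set_integrable_subset[of _ "{u..v}"]) (use assms in \<open>auto simp: locally_integrable_def\<close>)
  then show ?thesis by (simp add: interval_lebesgue_integrable_def)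
qed

lemma locally_integrable_sum:
  assumes "locally_integrable f"
  shows "(LBINT t=ereal a..ereal b. f t) + (LBINT t=ereal b..ereal c. f t) = (LBINT t=ereal a..ereal c. f t)"
proof (rule interval_integral_sum)
  have "min (ereal a) (min (ereal b) (ereal c)) = ereal (min a (min b c))"
    "max (ereal a) (max (ereal b) (ereal c)) = ereal (max a (max b c))"
    by (simp_all add: min_def max_def)
  then show "interval_lebesgue_integrable lborel (min (ereal a) (min (ereal b) (ereal c)))
      (max (ereal a) (max (ereal b) (ereal c))) f"
    using locally_integrable_interval[OF assms] by (simp only:)
qed

text \<open>The bridge to the gauge integral, whose indefinite integral has the continuity and
  differentiability results used below.\<close>

lemma locally_integrable_integral:
  assumes "locally_integrable f" "a \<le> b"
  shows "f integrable_on {a..b}" "(LBINT t=ereal a..ereal b. f t) = integral {a..b} f"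
  using assms interval_integral_eq_integral[of a b f] set_borel_integral_eq_integral(1)[of "{a..b}" f]
  by (auto simp: locally_integrable_def)

lemma locally_integrable_isCont:
  assumes "\<And>t. isCont f t" shows "locally_integrable f"
  unfolding locally_integrable_def
  using assms by (intro allI borel_integrable_atLeastAtMost' continuous_at_imp_continuous_on) auto

lemma indefinite_integral_isCont:
  assumes f: "locally_integrable f"
  shows "isCont (\<lambda>x. LBINT t=0..ereal x. f t) x"
proof -
  \<comment> \<open>Starting at \<open>x - 1\<close> instead of 0 puts \<open>x\<close> in the
    interior of the interval whatever its sign; additivity of the integral accounts for the change
    of base point.\<close>
  have "continuous_on {x-1..x+1} (\<lambda>u. (LBINT t=0..ereal (x-1). f t) + integral {x-1..u} f)"
    by (intro continuous_on_add continuous_on_const indefinite_integral_continuous_1 locally_integrable_integral f) simp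
  moreover have "(LBINT t=0..ereal (x-1). f t) + integral {x-1..u} f = (LBINT t=0..ereal u. f t)" if "u \<in> {x-1..x+1}" for u
    using locally_integrable_sum[OF f, of 0 "x-1" u] locally_integrable_integral(2)[OF f, of "x-1" u] that
    by (simp add: zero_ereal_def)
  ultimately have "continuous_on {x-1..x+1} (\<lambda>u. LBINT t=0..ereal u. f t)"
    by (rule continuous_on_eq)
  then show ?thesis by (rule continuous_on_interior) simp
qed

text \<open>By additivity the integrals from \<open>x - 1\<close> to all nearby \<open>u\<close>
  vanish as well, while their derivative at a continuity point \<open>x\<close> is
  \<open>f x\<close>.\<close>

lemma indefinite_integral_eq_0D:
  assumes f: "locally_integrable f" and 0: "\<And>x. (LBINT t=0..ereal x. f t) = 0" and x: "isCont f x"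
  shows "f x = 0"
proof -
  have "integral {x-1..u} f = 0" if "u \<in> {x-1..x+1}" for u
    using locally_integrable_sum[OF f, of 0 "x-1" u] locally_integrable_integral(2)[OF f, of "x-1" u] that 0
    by (simp add: zero_ereal_def)
  moreover have "((\<lambda>u. integral {x-1..u} f) has_vector_derivative f x) (at x within ({x-1..x+1} - {}))"
    using x by (intro integral_has_vector_derivative_continuous_at locally_integrable_integral f)
      (auto intro: continuous_at_imp_continuous_at_within)
  ultimately have "((\<lambda>u. 0) has_vector_derivative f x) (at x within {x-1..x+1})"
    by (intro has_vector_derivative_transform[of x "{x-1..x+1}" "\<lambda>u. 0" "\<lambda>u. integral {x-1..u} f"]) simp_all
  then have "((\<lambda>u. 0) has_vector_derivative f x) (at x)"
    by (simp add: at_within_Icc_at)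
  then show ?thesis using vector_derivative_unique_at has_vector_derivative_const by metis
qed

lemma BV_locally_integrable:
  assumes g: "g \<in> BV" shows "locally_integrable (\<lambda>t. g (ereal t))"
  unfolding locally_integrable_def set_integrable_def
proof (intro allI integrableI_bounded_set_indicator)
  fix a b :: real
  show "(\<lambda>t. g (ereal t)) \<in> borel_measurable lborel" using BV_borel_measurable[OF g] by simp
  show "emeasure lborel {a..b} < \<infinity>" by (simp add: emeasure_lborel_Icc_eq)
  show "AE t in lborel. t \<in> {a..b} \<longrightarrow> norm (g (ereal t)) \<le> sup_norm g"
    using BV_sup_norm[OF g] by simp
qed simp

lemma iter_int_Suc_ereal [simp]:
  "iter_int (Suc m) q (ereal x) = (LBINT t=0..ereal x. iter_int m q (ereal t))"
  by simp

lemma iter_int_Suc_infinity: "\<bar>x\<bar> = \<infinity> \<Longrightarrow> iter_int (Suc m) q x = 0"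
  by simp

declare iter_int.simps(2) [simp del]

lemma iter_int_locally_integrable: "g \<in> BV \<Longrightarrow> locally_integrable (\<lambda>t. iter_int m g (ereal t))"
proof (induction m)
  case 0
  then show ?case using BV_locally_integrable by simp
next
  case (Suc m)
  then show ?case by (auto intro: locally_integrable_isCont indefinite_integral_isCont)
qed

lemma iter_int_diff:
  assumes "g \<in> BV" "g' \<in> BV" shows "iter_int m (g - g') = iter_int m g - iter_int m g'"
proof (induction m)
  case (Suc m)
  show ?case
  proof
    fix x
    show "iter_int (Suc m) (g - g') x = (iter_int (Suc m) g - iter_int (Suc m) g') x"
    proof (cases "\<bar>x\<bar> = \<infinity>")
      case False
      then obtain r where x: "x = ereal r" by (cases x) auto
      have "interval_lebesgue_integrable lborel 0 (ereal r) (\<lambda>t. iter_int m g (ereal t))"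
        "interval_lebesgue_integrable lborel 0 (ereal r) (\<lambda>t. iter_int m g' (ereal t))"
        using locally_integrable_interval[OF iter_int_locally_integrable, of _ 0] assms
        unfolding zero_ereal_def by auto
      then show ?thesis by (simp add: x Suc)
    qed (simp add: iter_int_Suc_infinity)
  qed
qed simp

text \<open>Normalisation changes \<open>g\<close> only at its countably many discontinuities, a
  null set. The first integrals therefore agree everywhere, and all later ones have identical
  integrands.\<close>

lemma iter_int_normalisation:
  assumes g: "g \<in> BV" shows "iter_int (Suc m) (normalisation lam g) = iter_int (Suc m) g"
proof (induction m)
  case 0
  show ?case
  proof
    fix x
    show "iter_int (Suc 0) (normalisation lam g) x = iter_int (Suc 0) g x"
    proof (cases "\<bar>x\<bar> = \<infinity>")
      case False
      then obtain r where x: "x = ereal r" by (cases x) auto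
      have "(LBINT t=0..ereal r. normalisation lam g (ereal t)) = (LBINT t=0..ereal r. g (ereal t))"
        by (rule interval_integral_discrete_difference[OF BV_countable_discontinuities[OF g]])
          (auto simp del: normalisation_ereal intro: normalisation_isCont)
      then show ?thesis by (simp add: x)
    qed (simp add: iter_int_Suc_infinity)
  qed
next
  case (Suc m)
  then show ?case by (simp only: iter_int.simps(2)[of "Suc m"])
qed

text \<open>Integrals are removed from the outside. Every iterate of positive order is continuous
  and can be recovered at each point; only for the last one are the discontinuities of
  \<open>g\<close> an issue, and there \<open>NBV_eq_0\<close> takes over.\<close>

lemma iter_int_eq_0D:
  assumes g: "g \<in> NBV lam" and 0: "iter_int (Suc m) g = (\<lambda>x. 0)"
  shows "g = (\<lambda>x. 0)"
  using 0
proof (induction m)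
  case 0
  have "g (ereal t) = 0" if "isCont (\<lambda>t. g (ereal t)) t" for t
  proof (rule indefinite_integral_eq_0D[OF BV_locally_integrable[OF NBV_BV[OF g]] _ that])
    fix x show "(LBINT t=0..ereal x. g (ereal t)) = 0"
      using fun_cong[OF 0, of "ereal x"] by simp
  qed
  from NBV_eq_0[OF g this] show ?case by (rule ext)
next
  case (Suc m)
  have "iter_int (Suc m) g x = 0" for x
  proof (cases "\<bar>x\<bar> = \<infinity>")
    case False
    then obtain r where x: "x = ereal r" by (cases x) auto
    show ?thesis
      unfolding x
    proof (rule indefinite_integral_eq_0D[of "\<lambda>t. iter_int (Suc m) g (ereal t)"])
      show "locally_integrable (\<lambda>t. iter_int (Suc m) g (ereal t))"
        by (rule iter_int_locally_integrable[OF NBV_BV[OF g]])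
      show "(LBINT t=0..ereal y. iter_int (Suc m) g (ereal t)) = 0" for y
        using fun_cong[OF Suc.prems, of "ereal y"] by (simp only: iter_int_Suc_ereal)
      show "isCont (\<lambda>t. iter_int (Suc m) g (ereal t)) r"
        using indefinite_integral_isCont[OF iter_int_locally_integrable[OF NBV_BV[OF g]]] by simp
    qed
  qed (simp add: iter_int_Suc_infinity)
  then show ?case by (intro Suc.IH ext)
qed

lemma iter_int_inj:
  assumes g: "g \<in> NBV lam" "g' \<in> NBV lam" and eq: "iter_int (Suc m) g = iter_int (Suc m) g'"
  shows "g = g'"
proof -
  have "iter_int (Suc m) (g - g') = (\<lambda>x. 0)"
    unfolding iter_int_diff[OF NBV_BV[OF g(1)] NBV_BV[OF g(2)]] eq by (simp add: fun_eq_iff)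
  from fun_cong[OF iter_int_eq_0D[OF NBV_diff[OF g] this]] have "g x = g' x" for x by simp
  then show ?thesis by (rule ext)
qed

section \<open>The normalised representative of an iterated integral\<close>

lemma bv_part_eqI:
  assumes "g \<in> NBV lam" "h = iter_int (Suc m) g" shows "bv_part (Suc m) lam h = g"
proof -
  have "(THE g. g \<in> NBV lam \<and> h = iter_int (Suc m) g) = g"
    using assms iter_int_inj by (intro the_equality) auto
  then show ?thesis by (simp add: bv_part_def)
qed

text \<open>Any representative of bounded variation can be normalised without changing its iterated
  integral, which gives existence; injectivity on \<open>NBV\<close> identifies the result with the
  definite description.\<close>

lemma bv_part_Suc:
  assumes h: "h \<in> IBV (Suc m)" and lam: "0 \<le> lam" "lam \<le> 1"
  shows "bv_part (Suc m) lam h \<in> NBV lam" "h = iter_int (Suc m) (bv_part (Suc m) lam h)"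
proof -
  obtain g where g: "g \<in> BV" "h = iter_int (Suc m) g" using h unfolding IBV_def by blast
  have "normalisation lam g \<in> NBV lam" "h = iter_int (Suc m) (normalisation lam g)"
    using normalisation_NBV[OF g(1) lam] iter_int_normalisation[OF g(1)] g(2) by auto
  moreover from bv_part_eqI[OF this] have "bv_part (Suc m) lam h = normalisation lam g" .
  ultimately show "bv_part (Suc m) lam h \<in> NBV lam" "h = iter_int (Suc m) (bv_part (Suc m) lam h)"
    by simp_all
qed

lemma bv_part_BV:
  assumes "h \<in> IBV m" "0 \<le> lam" "lam \<le> 1" shows "bv_part m lam h \<in> BV"
proof (cases m)
  case 0
  then show ?thesis using assms(1) by (simp add: bv_part_def IBV_def)
next
  case (Suc k)
  then show ?thesis using bv_part_Suc(1) NBV_BV assms by metis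
qed

text \<open>This makes \<open>norm_IBV\<close> of a difference the \<open>norm_BV\<close> of the
  difference of representatives, the quantity in the continuity estimate.\<close>

lemma bv_part_diff:
  assumes h: "h \<in> IBV m" "h' \<in> IBV m" and lam: "0 \<le> lam" "lam \<le> 1"
  shows "bv_part m lam (h - h') = bv_part m lam h - bv_part m lam h'"
proof (cases m)
  case 0
  then show ?thesis by (simp add: bv_part_def)
next
  case (Suc k)
  note part = bv_part_Suc[OF h(1)[unfolded Suc] lam] bv_part_Suc[OF h(2)[unfolded Suc] lam]
  have "h - h' = iter_int (Suc k) (bv_part (Suc k) lam h - bv_part (Suc k) lam h')"
    unfolding iter_int_diff[OF NBV_BV[OF part(1)] NBV_BV[OF part(3)]]
    using part(2,4) by simp
  then show ?thesis unfolding Suc using NBV_diff[OF part(1,3)] by (intro bv_part_eqI)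
qed



theorem theorem19:
  fixes n :: nat and lam :: real
    and f :: "(real \<Rightarrow> real) \<Rightarrow> real" and fs :: "nat \<Rightarrow> (real \<Rightarrow> real) \<Rightarrow> real"
    and h :: "ereal \<Rightarrow> real" and hs :: "nat \<Rightarrow> ereal \<Rightarrow> real"
  assumes "n \<ge> 1" and "0 \<le> lam" and "lam \<le> 1"
    and "f \<in> A_r n" and "\<And>k. fs k \<in> A_r n"
    and "(\<lambda>k. norm_a n (fs k - f)) \<longlonglongrightarrow> 0"
    and "h \<in> IBV (n - 1)" and "\<And>k. hs k \<in> IBV (n - 1)"
    and "(\<lambda>k. norm_IBV (n - 1) lam (hs k - h)) \<longlonglongrightarrow> 0"
  shows "(\<lambda>k. integral_prod n lam (fs k) (hs k)) \<longlonglongrightarrow> integral_prod n lam f h"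
proof -
  define g F where "g = bv_part (n - 1) lam h" and "F = primitive n f"
  define gs Fs where "gs k = bv_part (n - 1) lam (hs k)" and "Fs k = primitive n (fs k)" for k
  have "(\<lambda>k. HS_integral (gs k) (Fs k)) \<longlonglongrightarrow> HS_integral g F"
  proof (rule HS_integral_tendsto)
    show "g \<in> BV" "gs k \<in> BV" for k
      unfolding g_def gs_def using assms by (intro bv_part_BV; simp)+
    show "F \<in> B_r" "Fs k \<in> B_r" for k
      unfolding F_def Fs_def using assms by (intro primitive_B_r; simp)+
    show "(\<lambda>k. norm_BV (gs k - g)) \<longlonglongrightarrow> 0"
      using assms(9) unfolding norm_IBV_def g_def gs_def bv_part_diff[OF assms(8,7,2,3)] .
    show "(\<lambda>k. sup_norm (Fs k - F)) \<longlonglongrightarrow> 0"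
      using assms(6) unfolding norm_a_def F_def Fs_def primitive_diff[OF assms(5,4)] .
  qed
  \<comment> \<open>The sign in \<open>integral_prod\<close> does not depend on \<open>k\<close>, so
    it acts as a constant factor.\<close>
  then show ?thesis
    unfolding integral_prod_def g_def F_def gs_def Fs_def by (intro tendsto_mult tendsto_const)
qed

end
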